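(* Let $n_1,n_2$ be positive integers and $n=\max\{n_1,n_2\}$. Let $\tau\in S_{n_1}$ be a $k$-Grassmannian permutation whose associated Young diagram has exactly two rows, $\lambda=(m_1,m_2)$ with $m_1\ge m_2>0$. Let $w\in S_{n_2}$ and write \[\mathfrak{S}_{w}\, s_{\lambda}(x_1,\dots,x_k)=\sum_{v} c_{w\tau}^{v}\,\mathfrak{S}_{v}.\] If $n_2-k<m_2$, then $c_{w\tau}^{v}\le 2^{n_2-k}(n_2-k)!$ for all $v$. If moreover $w(k+1)>w(k+2)>\cdots>w(n_2)$, then $c_{w\tau}^{v}\le 2^{n_2-k}$ for all $v$.
   Context: For $w\in S_N$, $\mathfrak{S}_w$ denotes the Schubert polynomial: $\mathfrak{S}_{w_0}=x_1^{N-1}x_2^{N-2}\cdots x_{N-1}$ for the longest element $w_0\in S_N$, and $\mathfrak{S}_{ws_i}=\partial_i\mathfrak{S}_w$ whenever $w(i)>w(i+1)$, where $\partial_i f=(f-s_if)/(x_i-x_{i+1})$ and $s_i$ swaps $x_i,x_{i+1}$. Permutations in $S_N$ are regarded as permutations of larger symmetric groups fixing the larger integers; Schubert polynomials are stable under this and form a basis of the polynomial ring, so the coefficients are well defined. A permutation $\tau\in S_{N}$ is $k$-Grassmannian if $\tau(1)<\dots<\tau(k)$ and $\tau(k+1)<\dots<\tau(N)$; its associated Young diagram is $\lambda=(\tau(k)-k,\dots,\tau(1)-1)$ (zero parts removed), and $\mathfrak{S}_\tau=s_\lambda(x_1,\dots,x_k)$, the Schur polynomial of shape $\lambda$ in $k$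 variables. *)

theory Defs
  imports "HOL-Library.Poly_Mapping" "HOL-Library.FuncSet"
    "HOL-Combinatorics.Transposition" "HOL-Combinatorics.Permutations"
begin

text \<open>
  Integer polynomials in the variables \<open>x_1, x_2, ...\<close>, as finitely supported coefficient
  functions on monomials; a monomial is a finitely supported exponent function.  The variable
  with index 0 is never used, so that indices agree with the usual numbering from 1.
\<close>

type_synonym zpoly = "(nat \<Rightarrow>\<^sub>0 nat) \<Rightarrow>\<^sub>0 int"

definition var :: "nat \<Rightarrow> zpoly" where
  "var i = Poly_Mapping.single (Poly_Mapping.single i 1) 1"

text \<open>
  The coefficient of a monomial \<open>m\<close> in \<open>swap_vars i f\<close> is the coefficient in \<open>f\<close> of \<open>m\<close> with the
  exponents at \<open>i\<close> and \<open>i + 1\<close> interchanged.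
\<close>

definition swap_vars :: "nat \<Rightarrow> zpoly \<Rightarrow> zpoly" where
  "swap_vars i f =
     Poly_Mapping.map_key (Poly_Mapping.map_key (transpose i (i + 1))) f"

definition divided_difference :: "nat \<Rightarrow> zpoly \<Rightarrow> zpoly" where
  "divided_difference i f = (THE g. (var i - var (i + 1)) * g = f - swap_vars i f)"

text \<open>
  Permutations in \<open>S_N\<close> are functions on \<^typ>\<open>nat\<close> fixing everything outside \<open>{1..N}\<close>; this
  builds in the inclusions of \<open>S_N\<close> into the larger symmetric groups.
\<close>

definition finitary_perms :: "(nat \<Rightarrow> nat) set" where
  "finitary_perms = {v. \<exists>N. v permutes {1..N}}"

definition longest_perm :: "nat \<Rightarrow> nat \<Rightarrow> nat" where
  "longest_perm N i = (if i \<in> {1..N} then N + 1 - i else i)"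

text \<open>
  The relation generated by the two defining rules of Schubert polynomials, for all \<open>N\<close> at once.
  If \<open>w \<in> S_N\<close> then \<open>w i > w (i + 1)\<close> with \<open>i \<ge> 1\<close> already forces \<open>i < N\<close>, so the second rule
  does not leave \<open>S_N\<close>.  That the polynomial related to a permutation is unique amounts to
  independence of the chosen chain of descents together with stability in \<open>N\<close>.
\<close>

inductive schubert_rel :: "(nat \<Rightarrow> nat) \<Rightarrow> zpoly \<Rightarrow> bool" where
  longest: "schubert_rel (longest_perm N) (\<Prod>i = 1..N. var i ^ (N - i))"
| descent: "schubert_rel w f \<Longrightarrow> 1 \<le> i \<Longrightarrow> w i > w (i + 1) \<Longrightarrow>
    schubert_rel (w \<circ> transpose i (i + 1)) (divided_difference i f)"

definition schubert :: "(nat \<Rightarrow> nat) \<Rightarrow> zpoly" where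
  "schubert w = (THE f. schubert_rel w f)"

definition grassmannian :: "nat \<Rightarrow> nat \<Rightarrow> (nat \<Rightarrow> nat) \<Rightarrow> bool" where
  "grassmannian N k \<tau> \<longleftrightarrow> \<tau> permutes {1..N} \<and> k \<le> N \<and>
     strict_mono_on {1..k} \<tau> \<and> strict_mono_on {k+1..N} \<tau>"

text \<open>
  The list \<open>(\<tau> k - k, \<dots>, \<tau> 1 - 1)\<close> without its zero entries.  For a \<open>k\<close>-Grassmannian \<open>\<tau>\<close> one
  has \<open>\<tau> i \<ge> i\<close> for \<open>1 \<le> i \<le> k\<close>, so the subtraction is never truncated.
\<close>

definition grassmannian_shape :: "nat \<Rightarrow> (nat \<Rightarrow> nat) \<Rightarrow> nat list" where
  "grassmannian_shape k \<tau> = filter (\<lambda>p. p > 0) (map (\<lambda>i. \<tau> i - i) (rev [1..<k+1]))"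

text \<open>
  Semistandard tableaux in English notation: \<open>(r, c)\<close> is the cell in row \<open>r\<close> and column \<open>c\<close>, both
  counted from 0, and the row lengths are given by the list \<open>sh\<close>.
\<close>

definition young_diagram :: "nat list \<Rightarrow> (nat \<times> nat) set" where
  "young_diagram sh = {(r, c). r < length sh \<and> c < sh ! r}"

definition ssyt :: "nat \<Rightarrow> nat list \<Rightarrow> (nat \<times> nat \<Rightarrow> nat) set" where
  "ssyt k sh = {T \<in> young_diagram sh \<rightarrow>\<^sub>E {1..k}.
     (\<forall>r c. (r, c + 1) \<in> young_diagram sh \<longrightarrow> T (r, c) \<le> T (r, c + 1)) \<and>
     (\<forall>r c. (r + 1, c) \<in> young_diagram sh \<longrightarrow> T (r, c) < T (r + 1, c))}"

definition schur :: "nat \<Rightarrow> nat list \<Rightarrow> zpoly" where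
  "schur k sh = (\<Sum>T \<in> ssyt k sh. \<Prod>b \<in> young_diagram sh. var (T b))"

end

theory Submission
  imports Defs "HOL-Library.Multiset"
begin

text \<open>
  The coefficient of \<open>S_v\<close> in a polynomial is the constant term of its divided difference along
  \<open>v\<close>.  By Jacobi--Trudi, \<open>s_(m1,m2) = h_m1 h_m2 - h_(m1+1) h_(m2-1)\<close>, and multiplication by
  \<open>h_m(x_1, \<dots>, x_k)\<close> is Schubert-positive and multiplicity free (Pieri), so the coefficient of
  \<open>S_v\<close> is at most the number of chains \<open>w \<rightarrow> u \<rightarrow> v\<close> of two Pieri steps.  A Pieri step shifts
  values cyclically within noncrossing blocks, each containing one position \<open>\<le> k\<close>, and this forces
  \<open>u\<close> to be determined by \<open>w\<close>, \<open>v\<close> and the set of positions \<open>> k\<close> that move in the first step.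
  The moved positions beyond \<open>n2\<close> form an initial segment of prescribed length, so only the
  \<open>2 ^ (n2 - k)\<close> subsets of \<open>{k+1..n2}\<close> matter.
\<close>

section \<open>Polynomials and divided differences\<close>

text \<open>Discarding h_(m1+1) h_(m2-1) is legitimate because that product is Schubert-positive as
  well. Both inequalities come from the one bound 2^(n2 - k), a factorial being at least 1.

  The obstacle in Pieri's rule is sign: the divided difference at i of h_m in variables indexed by I
  is negative when i + 1 lies in I and i does not. Descents of v other than k are therefore
  cancelled first, since they commute with h_m(x_1, ..., x_k). For the remaining Grassmannian v,
  cancelling always the last descent preserves a condition that puts every descent into I. On the
  way I ceases to be {1..k} and blocks may cross; only a positional weakening of noncrossing
  survives the induction, and it turns back into noncrossing at I = {1..k}.

  Uniqueness of u compares two candidates at the largest value that they place differently. Above it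
  all labels agree; noncrossing then makes both positions carrying this value labels, and the second
  step gives them the same label.\<close>

abbreviation adj :: "nat \<Rightarrow> nat \<Rightarrow> nat" where
  "adj i \<equiv> transpose i (Suc i)"

abbreviation dd :: "nat \<Rightarrow> zpoly \<Rightarrow> zpoly" where
  "dd \<equiv> divided_difference"

definition swap_exps :: "nat \<Rightarrow> (nat \<Rightarrow>\<^sub>0 nat) \<Rightarrow> (nat \<Rightarrow>\<^sub>0 nat)" where
  "swap_exps i = Poly_Mapping.map_key (adj i)"

lemma poly_mapping_single_induct [case_names zero add]:
  fixes f :: "'a \<Rightarrow>\<^sub>0 'b::monoid_add"
  assumes "P 0" and "\<And>f a b. P f \<Longrightarrow> P (f + Poly_Mapping.single a b)"
  shows "P f"
proof (induction f rule: Poly_Mapping.update_induct)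
  case const
  show ?case by (rule assms)
next
  case (update f a b)
  have "Poly_Mapping.update a b f = f + Poly_Mapping.single a b"
    using update by (intro poly_mapping_eqI)
      (auto simp: lookup_update lookup_add lookup_single when_def not_in_keys_iff_lookup_eq_zero)
  with assms(2) update show ?case by simp
qed

lemma lookup_swap_exps: "poly_mapping.lookup (swap_exps i m) j = poly_mapping.lookup m (adj i j)"
  by (simp add: swap_exps_def map_key.rep_eq)

lemma swap_exps_swap_exps [simp]: "swap_exps i (swap_exps i m) = m"
  by (intro poly_mapping_eqI) (simp add: lookup_swap_exps)

lemma swap_exps_add: "swap_exps i (m + n) = swap_exps i m + swap_exps i n"
  by (intro poly_mapping_eqI) (simp add: lookup_swap_exps lookup_add)

lemma swap_exps_zero [simp]: "swap_exps i 0 = 0"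
  by (intro poly_mapping_eqI) (simp add: lookup_swap_exps)

lemma swap_exps_single [simp]: "swap_exps i (Poly_Mapping.single j n) = Poly_Mapping.single (adj i j) n"
  by (intro poly_mapping_eqI)
    (auto simp: lookup_swap_exps lookup_single when_def transpose_eq_iff)

lemma inj_swap_exps: "inj (swap_exps i)"
  by (rule injI) (metis swap_exps_swap_exps)

lemma lookup_swap_vars: "poly_mapping.lookup (swap_vars i f) m = poly_mapping.lookup f (swap_exps i m)"
  using inj_swap_exps[of i] by (simp add: swap_vars_def swap_exps_def map_key.rep_eq)

lemma swap_vars_add: "swap_vars i (f + g) = swap_vars i f + swap_vars i g"
  by (intro poly_mapping_eqI) (simp add: lookup_swap_vars lookup_add)

lemma swap_vars_diff: "swap_vars i (f - g) = swap_vars i f - swap_vars i g"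
  by (intro poly_mapping_eqI) (simp add: lookup_swap_vars lookup_minus)

lemma swap_vars_zero [simp]: "swap_vars i 0 = 0"
  by (intro poly_mapping_eqI) (simp add: lookup_swap_vars)

lemma swap_vars_swap_vars [simp]: "swap_vars i (swap_vars i f) = f"
  by (intro poly_mapping_eqI) (simp add: lookup_swap_vars)

lemma swap_vars_single [simp]:
  "swap_vars i (Poly_Mapping.single m c) = Poly_Mapping.single (swap_exps i m) c"
  by (intro poly_mapping_eqI)
    (metis lookup_single_eq lookup_single_not_eq lookup_swap_vars swap_exps_swap_exps)

lemma swap_vars_mult: "swap_vars i (f * g) = swap_vars i f * swap_vars i g"
proof (induction f rule: poly_mapping_single_induct)
  case zero
  show ?case by simp
next
  case (add f a b)
  have "swap_vars i (Poly_Mapping.single a b * g) = swap_vars i (Poly_Mapping.single a b) * swap_vars i g"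
    by (induction g rule: poly_mapping_single_induct)
      (auto simp: mult_single swap_exps_add swap_vars_add distrib_left)
  with add show ?case by (simp add: distrib_right swap_vars_add)
qed

lemma swap_vars_of_int [simp]: "swap_vars i (of_int c) = of_int c"
proof -
  have "(of_int c :: zpoly) = Poly_Mapping.single 0 c"
    by (metis of_int_eq_id id_apply single_of_int)
  then show ?thesis by simp
qed

lemma swap_vars_one [simp]: "swap_vars i 1 = 1"
  using swap_vars_of_int[of i 1] by simp

lemma swap_vars_var [simp]: "swap_vars i (var j) = var (adj i j)"
  by (simp add: var_def)

lemma swap_vars_power: "swap_vars i (f ^ n) = swap_vars i f ^ n"
  by (induction n) (simp_all add: swap_vars_mult)

lemma swap_vars_sum: "swap_vars i (sum f A) = (\<Sum>x\<in>A. swap_vars i (f x))"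
  by (induction A rule: infinite_finite_induct) (simp_all add: swap_vars_add)

lemma single_eq_of_int_mult: "Poly_Mapping.single m c = of_int c * (Poly_Mapping.single m 1 :: zpoly)"
proof -
  have "(of_int c :: zpoly) = Poly_Mapping.single 0 c"
    by (metis of_int_eq_id id_apply single_of_int)
  then show ?thesis by (simp add: mult_single)
qed

lemma var_power: "var j ^ n = Poly_Mapping.single (Poly_Mapping.single j n) 1"
  by (induction n) (simp_all add: var_def mult_single flip: single_add)

lemma zpoly_induct [case_names of_int var add mult]:
  fixes f :: zpoly
  assumes "\<And>c. P (of_int c)" "\<And>i. P (var i)"
    "\<And>f g. P f \<Longrightarrow> P g \<Longrightarrow> P (f + g)" "\<And>f g. P f \<Longrightarrow> P g \<Longrightarrow> P (f * g)"
  shows "P f"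
proof (induction f rule: poly_mapping_single_induct)
  case zero
  show ?case using assms(1)[of 0] by simp
next
  case (add f m c)
  have P1: "P (var j ^ n)" for j n
    using assms(1)[of 1] by (induction n) (simp_all add: assms(2,4))
  have "P (Poly_Mapping.single m 1)"
  proof (induction m rule: poly_mapping_single_induct)
    case zero
    show ?case using assms(1)[of 1] by simp
  next
    case (add m j n)
    have "Poly_Mapping.single (m + Poly_Mapping.single j n) 1 = Poly_Mapping.single m 1 * var j ^ n"
      by (simp add: var_power mult_single)
    with assms(4) add P1 show ?case by metis
  qed
  then have "P (Poly_Mapping.single m c)"
    using assms(1,4) single_eq_of_int_mult by metis
  with add assms(3) show ?case by blast
qed

section \<open>Divided differences: existence, uniqueness, Leibniz' rule\<close>

lemma var_eq_iff [simp]: "var i = var j \<longleftrightarrow> i = j"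
  by (metis var_def lookup_single_eq lookup_single_not_eq zero_neq_one)

text \<open>Constants and variables have explicit quotients, and Leibniz' rule supplies the quotient
  for a product.\<close>

lemma dd_exists: "\<exists>g. (var i - var (Suc i)) * g = f - swap_vars i f"
proof (induction f rule: zpoly_induct)
  case (of_int c)
  show ?case by (rule exI[of _ 0]) simp
next
  case (var j)
  have "(var i - var (Suc i)) * (if j = i then 1 else if j = Suc i then - 1 else 0)
      = var j - swap_vars i (var j)"
    by (auto simp: transpose_def)
  then show ?case by blast
next
  case (add f g)
  then obtain a b where "(var i - var (Suc i)) * a = f - swap_vars i f"
    "(var i - var (Suc i)) * b = g - swap_vars i g" by blast
  then have "(var i - var (Suc i)) * (a + b) = f + g - swap_vars i (f + g)"
    by (simp add: distrib_left swap_vars_add)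
  then show ?case by blast
next
  case (mult f g)
  then obtain a b where ab: "(var i - var (Suc i)) * a = f - swap_vars i f"
    "(var i - var (Suc i)) * b = g - swap_vars i g" by blast
  have "(var i - var (Suc i)) * (a * g + swap_vars i f * b) =
     ((var i - var (Suc i)) * a) * g + swap_vars i f * ((var i - var (Suc i)) * b)"
    by (simp add: algebra_simps)
  also have "\<dots> = f * g - swap_vars i (f * g)"
    unfolding ab by (simp add: algebra_simps swap_vars_mult)
  finally show ?case by blast
qed

lemma dd_unique:
  assumes "(var i - var (Suc i)) * g = f - swap_vars i f"
  shows "dd i f = g"
  unfolding divided_difference_def
proof (rule the_equality)
  show "(var i - var (i + 1)) * g = f - swap_vars i f"
    using assms by simp
  show "g' = g" if "(var i - var (i + 1)) * g' = f - swap_vars i f" for g'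
    using that assms by (metis Suc_eq_plus1 mult_cancel_left n_not_Suc_n right_minus_eq var_eq_iff)
qed

lemma var_diff_mult_dd: "(var i - var (Suc i)) * dd i f = f - swap_vars i f"
  using dd_exists dd_unique by metis

lemma dd_add: "dd i (f + g) = dd i f + dd i g"
  by (rule dd_unique) (simp add: distrib_left var_diff_mult_dd swap_vars_add)

lemma dd_mult: "dd i (f * g) = dd i f * g + swap_vars i f * dd i g"
proof (rule dd_unique)
  have "(var i - var (Suc i)) * (dd i f * g + swap_vars i f * dd i g) =
     ((var i - var (Suc i)) * dd i f) * g + swap_vars i f * ((var i - var (Suc i)) * dd i g)"
    by (simp add: algebra_simps)
  also have "\<dots> = f * g - swap_vars i (f * g)"
    unfolding var_diff_mult_dd by (simp add: algebra_simps swap_vars_mult)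
  finally show "(var i - var (Suc i)) * (dd i f * g + swap_vars i f * dd i g) = f * g - swap_vars i (f * g)" .
qed

lemma dd_of_int [simp]: "dd i (of_int c) = 0"
  by (rule dd_unique) simp

lemma dd_zero [simp]: "dd i 0 = 0"
  by (rule dd_unique) simp

lemma dd_one [simp]: "dd i 1 = 0"
  by (rule dd_unique) simp

lemma dd_of_int_mult: "dd i (of_int c * f) = of_int c * dd i f"
  by (simp add: dd_mult)

lemma dd_sum: "dd i (sum f A) = (\<Sum>x\<in>A. dd i (f x))"
  by (induction A rule: infinite_finite_induct) (simp_all add: dd_add)

lemma dd_var: "dd i (var j) = (if j = i then 1 else if j = Suc i then - 1 else 0)"
  by (rule dd_unique) (auto simp: transpose_def)

lemma swap_vars_eq_if_dd_eq_0: "dd i f = 0 \<Longrightarrow> swap_vars i f = f"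
  using var_diff_mult_dd[of i f] by simp

lemma dd_eq_0_if_swap_vars_eq: "swap_vars i f = f \<Longrightarrow> dd i f = 0"
  by (rule dd_unique) simp

lemma swap_vars_dd [simp]: "swap_vars i (dd i f) = dd i f"
proof -
  have "swap_vars i ((var i - var (Suc i)) * dd i f) = swap_vars i (f - swap_vars i f)"
    by (simp add: var_diff_mult_dd)
  then have "(var (Suc i) - var i) * swap_vars i (dd i f) = swap_vars i f - f"
    by (simp add: swap_vars_mult swap_vars_diff)
  then have "(var i - var (Suc i)) * swap_vars i (dd i f) = f - swap_vars i f"
    by (simp add: algebra_simps)
  then show ?thesis using dd_unique by metis
qed

lemma dd_dd [simp]: "dd i (dd i f) = 0"
  by (rule dd_eq_0_if_swap_vars_eq) simp

section \<open>Commutation and braid relations\<close>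

lemma swap_vars_commute:
  assumes "Suc i < j"
  shows "swap_vars i (swap_vars j f) = swap_vars j (swap_vars i f)"
proof (intro poly_mapping_eqI)
  fix m
  have "swap_exps j (swap_exps i m) = swap_exps i (swap_exps j m)"
    using assms by (intro poly_mapping_eqI) (auto simp: lookup_swap_exps transpose_def)
  then show "poly_mapping.lookup (swap_vars i (swap_vars j f)) m = poly_mapping.lookup (swap_vars j (swap_vars i f)) m"
    by (simp add: lookup_swap_vars)
qed

lemma swap_vars_braid:
  "swap_vars i (swap_vars (Suc i) (swap_vars i f)) =
   swap_vars (Suc i) (swap_vars i (swap_vars (Suc i) f))"
proof (intro poly_mapping_eqI)
  fix m
  have "swap_exps i (swap_exps (Suc i) (swap_exps i m)) =
      swap_exps (Suc i) (swap_exps i (swap_exps (Suc i) m))"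
    by (intro poly_mapping_eqI) (auto simp: lookup_swap_exps transpose_def)
  then show "poly_mapping.lookup (swap_vars i (swap_vars (Suc i) (swap_vars i f))) m =
      poly_mapping.lookup (swap_vars (Suc i) (swap_vars i (swap_vars (Suc i) f))) m"
    by (simp add: lookup_swap_vars)
qed

lemma dd_commute:
  assumes "Suc i < j"
  shows "dd i (dd j f) = dd j (dd i f)"
proof -
  have sv: "swap_vars i (dd j f) = dd j (swap_vars i f)"
  proof (rule dd_unique[symmetric])
    have "swap_vars i ((var j - var (Suc j)) * dd j f) = swap_vars i (f - swap_vars j f)"
      by (simp add: var_diff_mult_dd)
    then show "(var j - var (Suc j)) * swap_vars i (dd j f) = swap_vars i f - swap_vars j (swap_vars i f)"
      using assms by (simp add: swap_vars_mult swap_vars_diff swap_vars_commute[OF assms] transpose_def)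
  qed
  show ?thesis
  proof (rule dd_unique)
    have "(var j - var (Suc j)) * ((var i - var (Suc i)) * dd j (dd i f)) =
      (var i - var (Suc i)) * (dd i f - swap_vars j (dd i f))"
      by (metis mult.left_commute var_diff_mult_dd)
    also have "swap_vars j ((var i - var (Suc i)) * dd i f) = (var i - var (Suc i)) * swap_vars j (dd i f)"
      using assms by (simp add: swap_vars_mult swap_vars_diff transpose_def)
    then have "(var i - var (Suc i)) * (dd i f - swap_vars j (dd i f)) =
        (f - swap_vars i f) - swap_vars j (f - swap_vars i f)"
      by (simp add: right_diff_distrib var_diff_mult_dd)
    also have "\<dots> = (f - swap_vars j f) - (swap_vars i f - swap_vars j (swap_vars i f))"
      by (simp add: swap_vars_diff)
    also have "\<dots> = (var j - var (Suc j)) * (dd j f - dd j (swap_vars i f))"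
      by (simp add: right_diff_distrib var_diff_mult_dd)
    finally show "(var i - var (Suc i)) * dd j (dd i f) = dd j f - swap_vars i (dd j f)"
      by (simp add: sv)
  qed
qed


text \<open>Multiplied by the Vandermonde product V of x_i, x_(i+1), x_(i+2), either side becomes
  the alternating sum of f over the six permutations of these variables. The two sums differ only in
  how the longest permutation is written, which \<open>swap_vars_braid\<close> settles, and V can be
  cancelled.\<close>

lemma dd_braid: "dd i (dd (Suc i) (dd i f)) = dd (Suc i) (dd i (dd (Suc i) f))"
proof -
  define x y z where "x = var i" and "y = var (Suc i)" and "z = var (Suc (Suc i))"
  define a b where "a = swap_vars i" and "b = swap_vars (Suc i)"
  define V where "V = (x - y) * (x - z) * (y - z)"
  have [simp]: "a x = y" "a y = x" "a z = z" "b x = x" "b y = z" "b z = y"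
    by (simp_all add: a_def b_def x_def y_def z_def transpose_def)
  have hom: "a (g + h) = a g + a h" "a (g - h) = a g - a h" "a (g * h) = a g * a h"
      "b (g + h) = b g + b h" "b (g - h) = b g - b h" "b (g * h) = b g * b h" for g h
    by (simp_all add: a_def b_def swap_vars_add swap_vars_diff swap_vars_mult)
  have [simp]: "a (a g) = g" "b (b g) = g" for g
    by (simp_all add: a_def b_def)
  have da: "(x - y) * dd i g = g - a g" and db: "(y - z) * dd (Suc i) g = g - b g" for g
    using var_diff_mult_dd[of i g] var_diff_mult_dd[of "Suc i" g]
    by (simp_all add: x_def y_def z_def a_def b_def)
  have ne: "x - y \<noteq> 0" "y - z \<noteq> 0" "x - z \<noteq> 0"
    by (simp_all add: x_def y_def z_def)
  then have V0: "V \<noteq> 0" by (simp add: V_def)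
  have aV: "a V = - V" and bV: "b V = - V"
    by (simp_all add: V_def hom algebra_simps)
  define h where "h = dd (Suc i) (dd i f)"
  have "b ((x - y) * dd i f) = b (f - a f)" by (simp add: da)
  then have 1: "(x - z) * b (dd i f) = b f - b (a f)" by (simp add: hom)
  have "V * h = (x - y) * (x - z) * ((y - z) * h)" by (simp add: V_def)
  also have "\<dots> = (x - z) * ((x - y) * dd i f) - (x - y) * ((x - z) * b (dd i f))"
    unfolding h_def db by (simp add: algebra_simps)
  finally have Vh: "V * h = (x - z) * (f - a f) - (x - y) * (b f - b (a f))"
    by (simp add: da 1)
  have "(x - y) * (V * dd i h) = V * ((x - y) * dd i h)" by (simp add: mult.left_commute)
  also have "\<dots> = V * h + a (V * h)" unfolding da by (simp add: hom aV algebra_simps)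
  also have "\<dots> = (x - y) * (f - a f - b f + b (a f) + a (b f) - a (b (a f)))"
    unfolding Vh by (simp add: hom algebra_simps)
  finally have L: "V * dd i h = f - a f - b f + b (a f) + a (b f) - a (b (a f))"
    using ne by simp
  define k where "k = dd i (dd (Suc i) f)"
  have "a ((y - z) * dd (Suc i) f) = a (f - b f)" by (simp add: db)
  then have 2: "(x - z) * a (dd (Suc i) f) = a f - a (b f)" by (simp add: hom)
  have "V * k = (x - z) * (y - z) * ((x - y) * k)" by (simp add: V_def algebra_simps)
  also have "\<dots> = (x - z) * ((y - z) * dd (Suc i) f) - (y - z) * ((x - z) * a (dd (Suc i) f))"
    unfolding k_def da by (simp add: algebra_simps)
  finally have Vk: "V * k = (x - z) * (f - b f) - (y - z) * (a f - a (b f))"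
    by (simp add: db 2)
  have "(y - z) * (V * dd (Suc i) k) = V * ((y - z) * dd (Suc i) k)" by (simp add: mult.left_commute)
  also have "\<dots> = V * k + b (V * k)" unfolding db by (simp add: hom bV algebra_simps)
  also have "\<dots> = (y - z) * (f - b f - a f + a (b f) + b (a f) - b (a (b f)))"
    unfolding Vk by (simp add: hom algebra_simps)
  finally have R: "V * dd (Suc i) k = f - b f - a f + a (b f) + b (a f) - b (a (b f))"
    using ne by simp
  have "a (b (a f)) = b (a (b f))"
    by (simp add: a_def b_def swap_vars_braid)
  with L R have "V * dd i h = V * dd (Suc i) k" by simp
  with V0 show ?thesis by (simp add: h_def k_def)
qed

section \<open>Divided differences along permutations\<close>

definition inversions :: "(nat \<Rightarrow> nat) \<Rightarrow> (nat \<times> nat) set" where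
  "inversions v = {(x, y). x < y \<and> v y < v x}"

definition perm_length :: "(nat \<Rightarrow> nat) \<Rightarrow> nat" where
  "perm_length v = card (inversions v)"

lemma finitary_perms_bij: "v \<in> finitary_perms \<Longrightarrow> bij v"
  by (auto simp: finitary_perms_def dest: permutes_bij)

lemma finitary_perms_zero: "v \<in> finitary_perms \<Longrightarrow> v 0 = 0"
  by (auto simp: finitary_perms_def permutes_def)

lemma finitary_perms_inj: "v \<in> finitary_perms \<Longrightarrow> v x = v y \<longleftrightarrow> x = y"
  by (meson bij_is_inj finitary_perms_bij inj_eq)

lemma id_finitary_perms [simp]: "id \<in> finitary_perms"
  by (auto simp: finitary_perms_def intro: permutes_id)

lemma permutes_mono_atLeastAtMost: "v permutes {1..N} \<Longrightarrow> N \<le> M \<Longrightarrow> v permutes {1..M::nat}"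
  by (erule permutes_subset) auto

lemma adj_permutes: "1 \<le> i \<Longrightarrow> i < N \<Longrightarrow> adj i permutes {1..N}"
  by (rule permutes_swap_id) auto

lemma finitary_perms_adj:
  assumes "v \<in> finitary_perms" "1 \<le> i"
  shows "v \<circ> adj i \<in> finitary_perms"
proof -
  obtain N where N: "v permutes {1..N}"
    using assms by (auto simp: finitary_perms_def)
  have "v permutes {1..max N (Suc i)}" "adj i permutes {1..max N (Suc i)}"
    using assms(2) by (intro permutes_mono_atLeastAtMost[OF N] adj_permutes; simp)+
  then show ?thesis
    unfolding finitary_perms_def using permutes_compose by blast
qed

lemma descent_pos: "v \<in> finitary_perms \<Longrightarrow> v (Suc i) < v i \<Longrightarrow> 1 \<le> i"
  by (cases i) (auto simp: finitary_perms_zero)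

lemma finite_inversions:
  assumes "v \<in> finitary_perms"
  shows "finite (inversions v)"
proof -
  obtain N where N: "v permutes {1..N}"
    using assms by (auto simp: finitary_perms_def)
  have "y \<le> N" if "x < y" "v y < v x" for x y
  proof (rule ccontr)
    assume "\<not> y \<le> N"
    then have "v y = y" using N by (auto simp: permutes_def)
    moreover have "v x \<le> max x N"
      using permutes_in_image[OF N, of x] N by (cases "x \<in> {1..N}") (auto simp: permutes_def)
    ultimately show False using that \<open>\<not> y \<le> N\<close> by auto
  qed
  then have "inversions v \<subseteq> {..N} \<times> {..N}"
    by (force simp: inversions_def)
  then show ?thesis by (rule finite_subset) auto
qed

text \<open>Applying \<open>adj i\<close> to both entries of a pair keeps their order except for the
  pair (i, i + 1), which is an inversion of v but not of the shorter permutation.\<close>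

lemma perm_length_adj:
  assumes "v \<in> finitary_perms" "v (Suc i) < v i"
  shows "perm_length v = Suc (perm_length (v \<circ> adj i))"
proof -
  have "bij_betw (map_prod (adj i) (adj i)) (inversions v - {(i, Suc i)}) (inversions (v \<circ> adj i))"
  proof (rule bij_betw_byWitness[where f' = "map_prod (adj i) (adj i)"])
    show "map_prod (adj i) (adj i) ` (inversions v - {(i, Suc i)}) \<subseteq> inversions (v \<circ> adj i)"
      by (auto simp: inversions_def) (auto simp: transpose_def split: if_splits)
    show "map_prod (adj i) (adj i) ` inversions (v \<circ> adj i) \<subseteq> inversions v - {(i, Suc i)}"
    proof (clarsimp simp: inversions_def, intro conjI impI)
      fix x y
      assume "x < y" "v (adj i y) < v (adj i x)"
      with assms(2) show "adj i x < adj i y"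
        by (auto simp: transpose_def split: if_splits)
      show "adj i x = i \<Longrightarrow> adj i y \<noteq> Suc i"
        using \<open>x < y\<close> by (auto simp: transpose_def split: if_splits)
    qed
  qed auto
  then have "card (inversions v - {(i, Suc i)}) = perm_length (v \<circ> adj i)"
    by (simp add: perm_length_def bij_betw_same_card)
  moreover have "(i, Suc i) \<in> inversions v"
    using assms by (simp add: inversions_def)
  ultimately show ?thesis
    using card_Suc_Diff1[OF finite_inversions[OF assms(1)], of "(i, Suc i)"]
    unfolding perm_length_def by simp
qed

lemma perm_length_adj_asc:
  assumes "v \<in> finitary_perms" "1 \<le> i" "v i < v (Suc i)"
  shows "perm_length (v \<circ> adj i) = Suc (perm_length v)"
  using perm_length_adj[OF finitary_perms_adj[OF assms(1,2)], of i] assms(3)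
  by (simp add: comp_assoc)

text \<open>An increasing bijection of the naturals never lowers a number, and neither does its
  inverse.\<close>

lemma finitary_perms_no_descent:
  assumes "v \<in> finitary_perms" "\<And>i. \<not> v (Suc i) < v i"
  shows "v = id"
proof -
  have "v i < v (Suc i)" for i
    using assms(2)[of i] finitary_perms_inj[OF assms(1), of i "Suc i"] by linarith
  then have "strict_mono v"
    by (simp add: strict_mono_Suc_iff)
  moreover have "strict_mono (inv v)"
    using \<open>strict_mono v\<close> finitary_perms_bij[OF assms(1)]
    by (metis bij_inv_eq_iff strict_mono_def strict_mono_less)
  ultimately have "v x = x" for x
    using strict_mono_imp_increasing[of v x] strict_mono_imp_increasing[of "inv v" "v x"]
      finitary_perms_bij[OF assms(1)] by (simp add: bij_is_inj)
  then show ?thesis by auto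
qed

lemma perm_length_eq_0: "v \<in> finitary_perms \<Longrightarrow> perm_length v = 0 \<Longrightarrow> v = id"
  using finitary_perms_no_descent perm_length_adj by (metis Zero_neq_Suc)

lemma perm_length_id [simp]: "perm_length id = 0"
proof -
  have "inversions id = {}" by (auto simp: inversions_def)
  then show ?thesis by (simp add: perm_length_def)
qed

lemma ex_descent: "v \<in> finitary_perms \<Longrightarrow> v \<noteq> id \<Longrightarrow> \<exists>i. v (Suc i) < v i"
  using finitary_perms_no_descent by blast

text \<open>
  \<open>dd_perm v\<close> is the composition of the \<^const>\<open>divided_difference\<close> operators along a reduced word
  of \<open>v\<close>, the last letter being applied first.
\<close>

fun dd_steps :: "nat \<Rightarrow> (nat \<Rightarrow> nat) \<Rightarrow> zpoly \<Rightarrow> zpoly" where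
  "dd_steps 0 v f = f"
| "dd_steps (Suc n) v f =
     dd_steps n (v \<circ> adj (SOME i. v (Suc i) < v i)) (dd (SOME i. v (Suc i) < v i) f)"

definition dd_perm :: "(nat \<Rightarrow> nat) \<Rightarrow> zpoly \<Rightarrow> zpoly" where
  "dd_perm v f = dd_steps (perm_length v) v f"

lemma dd_perm_id [simp]: "dd_perm id f = f"
  by (simp add: dd_perm_def)

lemma dd_perm_some_descent:
  assumes "v \<in> finitary_perms" "v (Suc i) < v i"
  obtains j where "v (Suc j) < v j" "\<And>f. dd_perm v f = dd_perm (v \<circ> adj j) (dd j f)"
proof
  let ?j = "SOME i. v (Suc i) < v i"
  show j: "v (Suc ?j) < v ?j"
    using assms(2) by (rule someI)
  show "dd_perm v f = dd_perm (v \<circ> adj ?j) (dd ?j f)" for f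
    using perm_length_adj[OF assms(1) j] by (simp add: dd_perm_def)
qed

lemma adj_comp_commute:
  assumes "Suc i < j"
  shows "v \<circ> adj i \<circ> adj j = v \<circ> adj j \<circ> adj i"
proof
  fix x
  consider "x = i" | "x = Suc i" | "x = j" | "x = Suc j" | "x \<notin> {i, Suc i, j, Suc j}" by blast
  then show "(v \<circ> adj i \<circ> adj j) x = (v \<circ> adj j \<circ> adj i) x"
    using assms by cases simp_all
qed

lemma adj_comp_braid:
  "v \<circ> adj i \<circ> adj (Suc i) \<circ> adj i = v \<circ> adj (Suc i) \<circ> adj i \<circ> adj (Suc i)"
proof
  fix x
  consider "x = i" | "x = Suc i" | "x = Suc (Suc i)" | "x \<notin> {i, Suc i, Suc (Suc i)}" by blast
  then show "(v \<circ> adj i \<circ> adj (Suc i) \<circ> adj i) x =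
      (v \<circ> adj (Suc i) \<circ> adj i \<circ> adj (Suc i)) x"
    by cases simp_all
qed

text \<open>Independence of the reduced word, in the manner of Matsumoto's theorem. Two descents i <
  j are compared by continuing both sides to a common permutation: one more letter on each side and
  commutation if they are far apart, two more letters and the braid relation if j = i + 1. The
  continuations start below the length of v, where the induction hypothesis covers every
  descent.\<close>

lemma dd_perm_descent:
  assumes "v \<in> finitary_perms" "v (Suc i) < v i"
  shows "dd_perm v f = dd_perm (v \<circ> adj i) (dd i f)"
  using assms
proof (induction "perm_length v" arbitrary: v i f rule: less_induct)
  case less
  have IH: "dd_perm u g = dd_perm (u \<circ> adj j) (dd j g)"
    if "u \<in> finitary_perms" "u (Suc j) < u j" "perm_length u < perm_length v" for u j g
    using less.hyps that by blast
  have eq: "dd_perm (v \<circ> adj i) (dd i f) = dd_perm (v \<circ> adj j) (dd j f)"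
    if ij: "v (Suc i) < v i" "v (Suc j) < v j" "i < j" for i j
  proof -
    have fin: "v \<circ> adj i \<in> finitary_perms" "v \<circ> adj j \<in> finitary_perms"
      using less.prems(1) ij descent_pos finitary_perms_adj by blast+
    have len: "perm_length (v \<circ> adj i) < perm_length v" "perm_length (v \<circ> adj j) < perm_length v"
      using perm_length_adj[OF less.prems(1) ij(1)] perm_length_adj[OF less.prems(1) ij(2)] by auto
    show ?thesis
    proof (cases "Suc i < j")
      case True
      have "dd_perm (v \<circ> adj i) (dd i f) = dd_perm (v \<circ> adj i \<circ> adj j) (dd j (dd i f))"
        using True ij by (intro IH fin len) (auto simp: transpose_def)
      moreover have "dd_perm (v \<circ> adj j) (dd j f) = dd_perm (v \<circ> adj j \<circ> adj i) (dd i (dd j f))"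
        using True ij by (intro IH fin len) (auto simp: transpose_def)
      ultimately show ?thesis
        by (simp only: dd_commute[OF True] adj_comp_commute[OF True])
    next
      case False
      with \<open>i < j\<close> have j: "j = Suc i" by simp
      define a b where "a = v \<circ> adj i" and "b = v \<circ> adj (Suc i)"
      define a' b' where "a' = a \<circ> adj (Suc i)" and "b' = b \<circ> adj i"
      have da: "a (Suc (Suc i)) < a (Suc i)" and db: "b (Suc i) < b i"
        and da': "a' (Suc i) < a' i" and db': "b' (Suc (Suc i)) < b' (Suc i)"
        using ij by (simp_all add: j a_def b_def a'_def b'_def transpose_def)
      have fin1: "a \<in> finitary_perms" "b \<in> finitary_perms"
        using fin by (simp_all add: a_def b_def j)
      have fin2: "a' \<in> finitary_perms" "b' \<in> finitary_perms"
        unfolding a'_def b'_def using fin1 da db descent_pos finitary_perms_adj by blast+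
      have len1: "perm_length a < perm_length v" "perm_length b < perm_length v"
        using len by (simp_all add: a_def b_def j)
      have len2: "perm_length a' < perm_length v" "perm_length b' < perm_length v"
        using len1 perm_length_adj[OF fin1(1) da] perm_length_adj[OF fin1(2) db]
        unfolding a'_def b'_def by linarith+
      have "dd_perm a (dd i f) = dd_perm (a' \<circ> adj i) (dd i (dd (Suc i) (dd i f)))"
        using IH[OF fin1(1) da len1(1)] IH[OF fin2(1) da' len2(1)] by (simp only: a'_def)
      moreover have "dd_perm b (dd (Suc i) f) =
          dd_perm (b' \<circ> adj (Suc i)) (dd (Suc i) (dd i (dd (Suc i) f)))"
        using IH[OF fin1(2) db len1(2)] IH[OF fin2(2) db' len2(2)] by (simp only: b'_def)
      moreover have "a' \<circ> adj i = b' \<circ> adj (Suc i)"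
        unfolding a'_def b'_def a_def b_def by (rule adj_comp_braid)
      ultimately show ?thesis
        unfolding j a_def b_def by (simp only: dd_braid)
    qed
  qed
  obtain j where j: "v (Suc j) < v j" "dd_perm v f = dd_perm (v \<circ> adj j) (dd j f)"
    using dd_perm_some_descent[OF less.prems] by metis
  show ?case
  proof (rule linorder_cases[of i j])
    assume "i < j"
    from eq[OF less.prems(2) j(1) this] j(2) show ?case by (simp only:)
  next
    assume "i = j"
    with j(2) show ?case by (simp only:)
  next
    assume "j < i"
    from eq[OF j(1) less.prems(2) this] j(2) show ?case by (simp only:)
  qed
qed

lemma dd_perm_asc:
  assumes "v \<in> finitary_perms" "1 \<le> i" "v i < v (Suc i)"
  shows "dd_perm v (dd i f) = dd_perm (v \<circ> adj i) f"
  using dd_perm_descent[OF finitary_perms_adj[OF assms(1,2)], of i f] assms(3)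
  by (simp add: comp_assoc)

lemma dd_perm_zero [simp]: "dd_perm v 0 = 0"
proof -
  have "dd_steps n v 0 = 0" for n
    by (induction n arbitrary: v) (simp_all only: dd_steps.simps dd_zero)
  then show ?thesis by (simp add: dd_perm_def)
qed

lemma dd_perm_desc:
  assumes "v \<in> finitary_perms" "v (Suc i) < v i"
  shows "dd_perm v (dd i f) = 0"
  using dd_perm_descent[OF assms, of "dd i f"] by simp

lemma dd_perm_add: "dd_perm v (f + g) = dd_perm v f + dd_perm v g"
proof -
  have "dd_steps n v (f + g) = dd_steps n v f + dd_steps n v g" for n
    by (induction n arbitrary: v f g) (simp_all add: dd_add)
  then show ?thesis by (simp add: dd_perm_def)
qed

lemma dd_perm_of_int_mult: "dd_perm v (of_int c * f) = of_int c * dd_perm v f"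
proof -
  have "dd_steps n v (of_int c * f) = of_int c * dd_steps n v f" for n
    by (induction n arbitrary: v f) (simp_all add: dd_of_int_mult)
  then show ?thesis by (simp add: dd_perm_def)
qed

lemma dd_perm_diff: "dd_perm v (f - g) = dd_perm v f - dd_perm v g"
  using dd_perm_add[of v "f - g" g] by simp

lemma dd_perm_sum: "dd_perm v (sum f A) = (\<Sum>x\<in>A. dd_perm v (f x))"
  by (induction A rule: infinite_finite_induct) (simp_all add: dd_perm_add)

section \<open>Monomials of divided differences\<close>

abbreviation expo :: "nat \<Rightarrow> nat \<Rightarrow> (nat \<Rightarrow>\<^sub>0 nat)" where
  "expo \<equiv> Poly_Mapping.single"

definition const_coeff :: "zpoly \<Rightarrow> int" where
  "const_coeff f = poly_mapping.lookup f 0"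

lemma const_coeff_simps [simp]:
  "const_coeff 0 = 0" "const_coeff 1 = 1" "const_coeff (f + g) = const_coeff f + const_coeff g"
  "const_coeff (f - g) = const_coeff f - const_coeff g"
  by (simp_all add: const_coeff_def lookup_add lookup_minus)

lemma const_coeff_sum: "const_coeff (sum f A) = (\<Sum>x\<in>A. const_coeff (f x))"
  by (simp add: const_coeff_def lookup_sum)

lemma const_coeff_var_mult [simp]: "const_coeff (var j * f) = 0"
proof (induction f rule: poly_mapping_single_induct)
  case (add f a b)
  have "const_coeff (var j * Poly_Mapping.single a b) = 0"
    by (auto simp: const_coeff_def var_def mult_single lookup_single when_def
        dest: arg_cong[where f = "\<lambda>m. poly_mapping.lookup m j"] simp: lookup_add)
  with add show ?case by (simp add: distrib_left)
qed simp

lemma of_int_mult_single: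
  "of_int c * Poly_Mapping.single m d = (Poly_Mapping.single m (c * d) :: zpoly)"
proof -
  have "(of_int c :: zpoly) = Poly_Mapping.single 0 c"
    by (metis of_int_eq_id id_apply single_of_int)
  then show ?thesis by (simp add: mult_single)
qed

lemma lookup_of_int_mult:
  "poly_mapping.lookup (of_int c * (f :: zpoly)) m = c * poly_mapping.lookup f m"
  by (induction f rule: poly_mapping_single_induct)
    (simp_all add: distrib_left lookup_add of_int_mult_single lookup_single when_def)

lemma const_coeff_of_int_mult [simp]: "const_coeff (of_int c * f) = c * const_coeff f"
  by (simp add: const_coeff_def lookup_of_int_mult)

lemma dd_eq_neg_dd_swap: "dd i f = - dd i (swap_vars i f)"
  by (rule dd_unique) (simp add: var_diff_mult_dd mult_minus_right)

lemma dd_var_powers: "dd i (var i ^ n) = (\<Sum>p<n. var (Suc i) ^ (n - Suc p) * var i ^ p)"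
  by (rule dd_unique) (simp add: swap_vars_power power_diff_sumr2)

text \<open>The monomial m times x_i^b x_(i+1)^b is symmetric and passes through; what remains is
  the quotient of x_i^n - x_(i+1)^n by x_i - x_(i+1).\<close>

lemma dd_monomial:
  assumes "poly_mapping.lookup m i = 0" "poly_mapping.lookup m (Suc i) = 0"
  shows "dd i (Poly_Mapping.single (m + expo i (b + n) + expo (Suc i) b) 1) =
    (\<Sum>p<n. Poly_Mapping.single (m + expo i (b + p) + expo (Suc i) (b + (n - Suc p))) 1)"
proof -
  have sw: "swap_exps i m = m"
    using assms by (intro poly_mapping_eqI) (auto simp: lookup_swap_exps transpose_def)
  define g where "g = (Poly_Mapping.single (m + expo i b + expo (Suc i) b) 1 :: zpoly)"
  have "swap_vars i g = g"
    by (simp add: g_def swap_exps_add sw add_ac)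
  then have "dd i (g * var i ^ n) = g * dd i (var i ^ n)"
    by (simp add: dd_mult dd_eq_0_if_swap_vars_eq)
  moreover have "Poly_Mapping.single (m + expo i (b + n) + expo (Suc i) b) 1 = g * var i ^ n"
    by (simp add: g_def var_power mult_single single_add add_ac)
  moreover have "g * (var (Suc i) ^ (n - Suc p) * var i ^ p) =
      Poly_Mapping.single (m + expo i (b + p) + expo (Suc i) (b + (n - Suc p))) 1" for p
    by (simp add: g_def var_power mult_single single_add add_ac)
  ultimately show ?thesis
    by (simp add: dd_var_powers sum_distrib_left)
qed

lemma monomial_decomp:
  obtains \<mu> where "m = \<mu> + expo i (poly_mapping.lookup m i) + expo (Suc i) (poly_mapping.lookup m (Suc i))"
    "poly_mapping.lookup \<mu> i = 0" "poly_mapping.lookup \<mu> (Suc i) = 0"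
proof
  define \<mu> where "\<mu> = Poly_Mapping.update i 0 (Poly_Mapping.update (Suc i) 0 m)"
  show "m = \<mu> + expo i (poly_mapping.lookup m i) + expo (Suc i) (poly_mapping.lookup m (Suc i))"
    by (intro poly_mapping_eqI) (auto simp: \<mu>_def lookup_add lookup_update lookup_single when_def)
  show "poly_mapping.lookup \<mu> i = 0" "poly_mapping.lookup \<mu> (Suc i) = 0"
    by (simp_all add: \<mu>_def lookup_update)
qed

text \<open>A single support estimate, from which the statements on staircases, on degrees and on
  the absence of variable 0 all follow: the exponents at i and i + 1 lose one in total, and their
  maximum drops strictly.\<close>

lemma keys_dd:
  assumes "Poly_Mapping.keys f \<subseteq> Q"
    and Q': "\<And>\<mu> a b c d. \<lbrakk>\<mu> + expo i a + expo (Suc i) b \<in> Q; poly_mapping.lookup \<mu> i = 0;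
      poly_mapping.lookup \<mu> (Suc i) = 0; Suc (c + d) = a + b; max c d < max a b\<rbrakk> \<Longrightarrow>
      \<mu> + expo i c + expo (Suc i) d \<in> Q'"
  shows "Poly_Mapping.keys (dd i f) \<subseteq> Q'"
proof -
  have mono: "Poly_Mapping.keys (dd i (Poly_Mapping.single m 1)) \<subseteq> Q'" if "m \<in> Q" for m
  proof -
    obtain \<mu> where \<mu>: "m = \<mu> + expo i (poly_mapping.lookup m i) + expo (Suc i) (poly_mapping.lookup m (Suc i))"
      and \<mu>0: "poly_mapping.lookup \<mu> i = 0" "poly_mapping.lookup \<mu> (Suc i) = 0"
      by (rule monomial_decomp)
    define a b where "a = poly_mapping.lookup m i" and "b = poly_mapping.lookup m (Suc i)"
    have m: "m = \<mu> + expo i a + expo (Suc i) b"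
      using \<mu> by (simp add: a_def b_def)
    have sw: "swap_exps i \<mu> = \<mu>"
      using \<mu>0 by (intro poly_mapping_eqI) (auto simp: lookup_swap_exps transpose_def)
    obtain r n where rn: "max a b = r + n" "min a b = r"
      by (metis le_add_diff_inverse max.cobounded1 min.coboundedI1 min.commute)
    have "Poly_Mapping.keys (dd i (Poly_Mapping.single (\<mu> + expo i (r + n) + expo (Suc i) r) 1)) \<subseteq> Q'"
    proof -
      have "Poly_Mapping.keys (Poly_Mapping.single (\<mu> + expo i (r + p) + expo (Suc i) (r + (n - Suc p))) (1::int)) \<subseteq> Q'"
        if "p < n" for p
        using Q'[of \<mu> a b "r + p" "r + (n - Suc p)"] \<open>m \<in> Q\<close> m \<mu>0 rn that
        by (auto simp: max_def min_def split: if_splits)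
      then show ?thesis
        unfolding dd_monomial[OF \<mu>0] by (intro order_trans[OF keys_sum] UN_least) auto
    qed
    moreover have "dd i (Poly_Mapping.single m 1) = dd i (Poly_Mapping.single (\<mu> + expo i (r + n) + expo (Suc i) r) 1)
      \<or> dd i (Poly_Mapping.single m 1) = - dd i (Poly_Mapping.single (\<mu> + expo i (r + n) + expo (Suc i) r) 1)"
    \<comment> \<open>For a < b the swapped monomial has the form treated above, at the price of a
      sign that leaves the support unchanged.\<close>
    proof (cases "a \<ge> b")
      case True
      then have "a = r + n" "b = r" using rn by auto
      then show ?thesis using m by simp
    next
      case False
      then have "a = r" "b = r + n" using rn by auto
      then have "swap_vars i (Poly_Mapping.single m 1) =
          Poly_Mapping.single (\<mu> + expo i (r + n) + expo (Suc i) r) 1"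
        using m by (simp add: swap_exps_add sw add_ac)
      then show ?thesis using dd_eq_neg_dd_swap by metis
    qed
    ultimately show ?thesis by auto
  qed
  have "f = (\<Sum>m\<in>Poly_Mapping.keys f. of_int (poly_mapping.lookup f m) * Poly_Mapping.single m 1)"
    by (intro poly_mapping_eqI)
      (simp add: of_int_mult_single lookup_sum lookup_single when_def sum.delta' in_keys_iff)
  then have "dd i f = dd i (\<Sum>m\<in>Poly_Mapping.keys f. of_int (poly_mapping.lookup f m) * Poly_Mapping.single m 1)"
    by (rule arg_cong)
  then have "dd i f = (\<Sum>m\<in>Poly_Mapping.keys f. of_int (poly_mapping.lookup f m) * dd i (Poly_Mapping.single m 1))"
    by (simp only: dd_sum dd_of_int_mult)
  moreover have "Poly_Mapping.keys (of_int c * g) \<subseteq> Poly_Mapping.keys g" for c and g :: zpoly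
    by (auto simp: in_keys_iff lookup_of_int_mult)
  ultimately show ?thesis
    using mono assms(1) by (auto intro!: order_trans[OF keys_sum] UN_least dest!: subsetD)
qed

section \<open>Degree and staircase support\<close>

definition monomial_degree :: "(nat \<Rightarrow>\<^sub>0 nat) \<Rightarrow> nat" where
  "monomial_degree m = (\<Sum>j\<in>Poly_Mapping.keys m. poly_mapping.lookup m j)"

lemma monomial_degree_zero [simp]: "monomial_degree 0 = 0"
  by (simp add: monomial_degree_def)

lemma monomial_degree_add: "monomial_degree (m + n) = monomial_degree m + monomial_degree n"
  unfolding monomial_degree_def by (rule setsum_keys_plus_distrib) simp_all

lemma monomial_degree_expo [simp]: "monomial_degree (expo j n) = n"
  by (simp add: monomial_degree_def)

text \<open>The monomials dividing x_1^(N-1) x_2^(N-2) ... x_(N-1). At j = 0 the general bound would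
  allow N, so the dummy variable is excluded separately.\<close>

definition staircase :: "nat \<Rightarrow> (nat \<Rightarrow>\<^sub>0 nat) set" where
  "staircase N = {m. poly_mapping.lookup m 0 = 0 \<and> (\<forall>j. poly_mapping.lookup m j \<le> N - j)}"

lemma keys_dd_staircase:
  assumes "Poly_Mapping.keys f \<subseteq> staircase N" "1 \<le> i"
  shows "Poly_Mapping.keys (dd i f) \<subseteq> staircase N"
proof (rule keys_dd[OF assms(1)])
  fix \<mu> a b c d
  assume *: "\<mu> + expo i a + expo (Suc i) b \<in> staircase N" "poly_mapping.lookup \<mu> i = 0"
    "poly_mapping.lookup \<mu> (Suc i) = 0" "Suc (c + d) = a + b" "max c d < max a b"
  have le: "poly_mapping.lookup (\<mu> + expo i a + expo (Suc i) b) j \<le> N - j" for j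
    using *(1) by (simp add: staircase_def)
  have "a \<le> N - i" "b \<le> N - Suc i"
    using le[of i] le[of "Suc i"] *(2,3) by (simp_all add: lookup_add lookup_single when_def)
  then have cd: "c \<le> N - Suc i" "d \<le> N - Suc i" "c \<le> N - i"
    using *(5) by auto
  have "poly_mapping.lookup (\<mu> + expo i c + expo (Suc i) d) j \<le> N - j" for j
    using le[of j] cd *(2,3) by (auto simp: lookup_add lookup_single when_def)
  then show "\<mu> + expo i c + expo (Suc i) d \<in> staircase N"
    using *(1) assms(2) by (auto simp: staircase_def lookup_add lookup_single when_def)
qed

lemma dd_staircase_eq_0:
  assumes "Poly_Mapping.keys f \<subseteq> staircase N" "N \<le> i"
  shows "dd i f = 0"
proof -
  have "Poly_Mapping.keys (dd i f) \<subseteq> {}"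
  proof (rule keys_dd[OF assms(1)])
    fix \<mu> a b c d
    assume *: "\<mu> + expo i a + expo (Suc i) b \<in> staircase N" "Suc (c + d) = a + b"
    have le: "poly_mapping.lookup (\<mu> + expo i a + expo (Suc i) b) j \<le> N - j" for j
      using *(1) by (simp add: staircase_def)
    have "a = 0" "b = 0"
      using le[of i] le[of "Suc i"] assms(2) by (simp_all add: lookup_add lookup_single when_def)
    then show "\<mu> + expo i c + expo (Suc i) d \<in> {}" using *(2) by simp
  qed
  then show ?thesis by simp
qed

text \<open>A reduced word of v contains a letter i with N \<le> i. Letters below N keep the support
  in the staircase, and the first larger one to be applied meets a polynomial free of x_i and
  x_(i+1).\<close>

lemma dd_perm_staircase_eq_0:
  assumes "v \<in> finitary_perms" "\<not> v permutes {1..N}" "Poly_Mapping.keys f \<subseteq> staircase N"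
  shows "dd_perm v f = 0"
  using assms
proof (induction "perm_length v" arbitrary: v f)
  case 0
  then show ?case using perm_length_eq_0 permutes_id by metis
next
  case (Suc n)
  have "v \<noteq> id" using Suc.prems(2) permutes_id by metis
  then obtain i where i: "v (Suc i) < v i" using ex_descent Suc.prems(1) by blast
  have i1: "1 \<le> i" using descent_pos Suc.prems(1) i by blast
  show ?case
  proof (cases "N \<le> i")
    case True
    then show ?thesis
      using dd_perm_descent[OF Suc.prems(1) i] dd_staircase_eq_0[OF Suc.prems(3)] by simp
  next
    case False
    have "\<not> (v \<circ> adj i) permutes {1..N}"
    proof
      assume "(v \<circ> adj i) permutes {1..N}"
      then have "(v \<circ> adj i \<circ> adj i) permutes {1..N}"
        using permutes_compose[OF adj_permutes[of i N]] i1 False by auto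
      then show False using Suc.prems(2) by (simp add: comp_assoc)
    qed
    then have "dd_perm (v \<circ> adj i) (dd i f) = 0"
      using Suc.hyps(2) perm_length_adj[OF Suc.prems(1) i]
      by (intro Suc.hyps(1) finitary_perms_adj Suc.prems i1 keys_dd_staircase) auto
    then show ?thesis using dd_perm_descent[OF Suc.prems(1) i] by simp
  qed
qed

lemma keys_dd_degree:
  assumes "Poly_Mapping.keys f \<subseteq> {m. monomial_degree m = d}"
  shows "Poly_Mapping.keys (dd i f) \<subseteq> {m. Suc (monomial_degree m) = d}"
  by (rule keys_dd[OF assms]) (auto simp: monomial_degree_add)

text \<open>In this additive form the right-hand set is empty when \<open>perm_length v\<close>
  exceeds d, so vanishing in that case is included.\<close>

lemma keys_dd_perm_degree:
  assumes "v \<in> finitary_perms" "Poly_Mapping.keys f \<subseteq> {m. monomial_degree m = d}"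
  shows "Poly_Mapping.keys (dd_perm v f) \<subseteq> {m. monomial_degree m + perm_length v = d}"
  using assms
proof (induction "perm_length v" arbitrary: v f d)
  case 0
  then have v: "v = id" using perm_length_eq_0 by metis
  show ?case using 0(3) by (simp only: v dd_perm_id perm_length_id add_0_right)
next
  case (Suc n)
  have "v \<noteq> id" using Suc.hyps(2) by auto
  then obtain i where i: "v (Suc i) < v i" using ex_descent Suc.prems(1) by blast
  have len: "n = perm_length (v \<circ> adj i)"
    using Suc.hyps(2) perm_length_adj[OF Suc.prems(1) i] by simp
  show ?case
  proof (cases d)
    case 0
    then have "dd i f = 0" using keys_dd_degree[OF Suc.prems(2)] by simp
    then show ?thesis using dd_perm_descent[OF Suc.prems(1) i] by simp
  next
    case (Suc d')
    then have "Poly_Mapping.keys (dd i f) \<subseteq> {m. monomial_degree m = d'}"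
      using keys_dd_degree[OF Suc.prems(2)] by auto
    from Suc.hyps(1)[OF len finitary_perms_adj[OF Suc.prems(1)] this]
    show ?thesis
      using dd_perm_descent[OF Suc.prems(1) i] descent_pos[OF Suc.prems(1) i] Suc
        perm_length_adj[OF Suc.prems(1) i] by auto
  qed
qed

lemma const_coeff_dd_perm_degree:
  assumes "v \<in> finitary_perms" "Poly_Mapping.keys f \<subseteq> {m. monomial_degree m = d}" "perm_length v \<noteq> d"
  shows "const_coeff (dd_perm v f) = 0"
  using keys_dd_perm_degree[OF assms(1,2)] assms(3)
  by (auto simp: const_coeff_def in_keys_iff subset_iff)

section \<open>Duality of Schubert polynomials and divided differences\<close>

lemma prod_var_eq_single:
  "finite A \<Longrightarrow> (\<Prod>j\<in>A. var j ^ e j) = Poly_Mapping.single (\<Sum>j\<in>A. expo j (e j)) 1"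
  by (induction A rule: finite_induct) (simp_all add: var_power mult_single)

lemma swap_vars_prod: "swap_vars i (prod f A) = (\<Prod>x\<in>A. swap_vars i (f x))"
  by (induction A rule: infinite_finite_induct) (simp_all add: swap_vars_mult)

lemma swap_vars_prod_var:
  assumes "adj i permutes A"
  shows "swap_vars i (\<Prod>j\<in>A. var j ^ e j) = (\<Prod>j\<in>A. var j ^ e (adj i j))"
proof -
  have "(\<Prod>j\<in>A. var (adj i j) ^ e (adj i (adj i j))) = (\<Prod>j\<in>A. var j ^ e (adj i j))"
    using prod.reindex_bij_betw[OF permutes_imp_bij[OF assms], of "\<lambda>j. var j ^ e (adj i j)"] by simp
  then show ?thesis by (simp add: swap_vars_prod swap_vars_power)
qed

lemma longest_perm_permutes: "longest_perm N permutes {1..N}"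
proof -
  have inv: "longest_perm N (longest_perm N x) = x" for x
    by (auto simp: longest_perm_def)
  have "longest_perm N x = x" if "x \<notin> {1..N}" for x
    using that by (auto simp: longest_perm_def)
  then show ?thesis
    unfolding permutes_def by (metis inv)
qed

lemma longest_perm_finitary: "longest_perm N \<in> finitary_perms"
  using longest_perm_permutes by (auto simp: finitary_perms_def)

lemma dd_perm_longest_perm: "dd_perm (longest_perm N) (\<Prod>i = 1..N. var i ^ (N - i)) = 1"
proof (induction N)
  case 0
  have "longest_perm 0 = id" by (auto simp: longest_perm_def)
  then show ?case by (simp only: dd_perm_id) simp
next
  case (Suc M)
  \<comment> \<open>\<open>p t\<close> is the longest permutation after the letters 1, ..., t have
    been cancelled: the value M + 1 has travelled to position t + 1. \<open>e t\<close> holds the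
    exponents left at that stage, one having been taken from each of x_1, ..., x_t.\<close>
  define p where "p t j = (if 1 \<le> j \<and> j \<le> t then Suc M - j else if j = Suc t then Suc M
    else if j \<le> Suc M \<and> Suc t < j then Suc (Suc M) - j else j)" for t j
  define e where "e t j = (if j \<le> t then M - j else Suc M - j)" for t j :: nat
  have "p t \<in> finitary_perms \<and> dd_perm (longest_perm (Suc M)) (\<Prod>i = 1..Suc M. var i ^ (Suc M - i)) =
      dd_perm (p t) (\<Prod>i = 1..Suc M. var i ^ e t i)" if "t \<le> M" for t
    using that
  proof (induction t)
    case 0
    have "p 0 = longest_perm (Suc M)" by (auto simp: p_def longest_perm_def fun_eq_iff)
    moreover have "(\<Prod>i = 1..Suc M. var i ^ (Suc M - i)) = (\<Prod>i = 1..Suc M. var i ^ e 0 i)"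
      by (rule prod.cong) (auto simp: e_def)
    ultimately show ?case using longest_perm_finitary by metis
  next
    case (Suc t)
    let ?i = "Suc t"
    have fin: "p t \<in> finitary_perms" using Suc by simp
    have desc: "p t (Suc ?i) < p t ?i"
      using Suc.prems by (simp add: p_def)
    have p: "p (Suc t) = p t \<circ> adj ?i"
    proof
      fix j
      consider "j = ?i" | "j = Suc ?i" | "j \<noteq> ?i \<and> j \<noteq> Suc ?i" by blast
      then show "p (Suc t) j = (p t \<circ> adj ?i) j"
        using Suc.prems by cases (auto simp: p_def)
    qed
    define G where "G = (\<Prod>i = 1..Suc M. var i ^ e (Suc t) i)"
    have "swap_vars ?i G = (\<Prod>j = 1..Suc M. var j ^ e (Suc t) (adj ?i j))"
      unfolding G_def using Suc.prems by (intro swap_vars_prod_var adj_permutes) auto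
    also have "\<dots> = G"
      unfolding G_def by (rule prod.cong) (auto simp: e_def transpose_def)
    finally have sG: "swap_vars ?i G = G" .
    \<comment> \<open>The exponent of x_(t+1) exceeds that of x_(t+2) by exactly one, so the
      monomial is x_(t+1) times the symmetric factor \<open>G\<close>.\<close>
    have "(\<Prod>i = 1..Suc M. var i ^ e t i) = (\<Prod>i = 1..Suc M. (if i = ?i then var i else 1) * var i ^ e (Suc t) i)"
      using Suc.prems by (intro prod.cong) (auto simp: e_def Suc_diff_Suc simp flip: power_Suc)
    also have "\<dots> = var ?i * G"
      using Suc.prems by (simp add: prod.distrib G_def prod.delta)
    finally have "dd ?i (\<Prod>i = 1..Suc M. var i ^ e t i) = G"
      using sG by (simp add: dd_mult dd_var dd_eq_0_if_swap_vars_eq)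
    then have "dd_perm (p t) (\<Prod>i = 1..Suc M. var i ^ e t i) = dd_perm (p (Suc t)) G"
      using dd_perm_descent[OF fin desc] p by metis
    moreover have "p (Suc t) \<in> finitary_perms"
      unfolding p by (rule finitary_perms_adj[OF fin]) simp
    ultimately show ?case using Suc unfolding G_def by simp
  qed
  from this[of M] have "dd_perm (longest_perm (Suc M)) (\<Prod>i = 1..Suc M. var i ^ (Suc M - i)) =
      dd_perm (p M) (\<Prod>i = 1..Suc M. var i ^ e M i)" by simp
  also have "p M = longest_perm M"
    by (auto simp: p_def longest_perm_def fun_eq_iff)
  also have "(\<Prod>i = 1..Suc M. var i ^ e M i) = (\<Prod>i = 1..M. var i ^ e M i)"
    by (simp add: e_def)
  also have "\<dots> = (\<Prod>i = 1..M. var i ^ (M - i))"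
    by (rule prod.cong) (auto simp: e_def)
  finally show ?case using Suc.IH by simp
qed

definition pos_pairs :: "nat \<Rightarrow> (nat \<times> nat) set" where
  "pos_pairs N = (SIGMA x:{1..N}. {x<..N})"

lemma finite_pos_pairs: "finite (pos_pairs N)"
  by (simp add: pos_pairs_def)

lemma card_pos_pairs: "card (pos_pairs N) = (\<Sum>i = 1..N. N - i)"
  by (simp add: pos_pairs_def card_SigmaI)

lemma inversions_subset_pos_pairs:
  assumes "v permutes {1..N}"
  shows "inversions v \<subseteq> pos_pairs N"
proof (clarsimp simp: inversions_def pos_pairs_def)
  fix x y
  assume xy: "x < y" "v y < v x"
  have fix_out: "v z = z" if "z \<notin> {1..N}" for z
    using assms that by (simp add: permutes_def)
  have in_img: "v z \<in> {1..N} \<longleftrightarrow> z \<in> {1..N}" for z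
    by (rule permutes_in_image[OF assms])
  have "x \<in> {1..N}"
  proof (rule ccontr)
    assume *: "x \<notin> {1..N}"
    show False
      using xy fix_out[OF *] * fix_out[of y] in_img[of y] by (cases "y \<in> {1..N}") auto
  qed
  moreover have "y \<in> {1..N}"
    using xy fix_out[of y] in_img[of x] \<open>x \<in> {1..N}\<close> by (cases "y \<in> {1..N}") auto
  ultimately show "Suc 0 \<le> x \<and> x \<le> N \<and> y \<le> N" by auto
qed

text \<open>Each value drops by at least one, which bounds \<open>w x\<close> from above when
  counting from position 1 and from below when counting from position N; the two bounds
  meet.\<close>

lemma decreasing_perm_eq_longest_perm:
  assumes "w permutes {1..N}" "\<And>i. 1 \<le> i \<Longrightarrow> i < N \<Longrightarrow> w (Suc i) < w i"
  shows "w = longest_perm N"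
proof
  fix x
  have in_img: "w z \<in> {1..N}" if "z \<in> {1..N}" for z
    using permutes_in_image[OF assms(1)] that by blast
  have up: "w (Suc j) + j \<le> N" if "Suc j \<le> N" for j
    using that
  proof (induction j)
    case 0
    then show ?case using in_img[of 1] by auto
  next
    case (Suc j)
    then show ?case using assms(2)[of "Suc j"] by auto
  qed
  have low: "Suc j \<le> w (N - j)" if "j < N" for j
    using that
  proof (induction j)
    case 0
    then show ?case using in_img[of N] by auto
  next
    case (Suc j)
    then have "w (N - j) < w (N - Suc j)" using assms(2)[of "N - Suc j"] by (simp add: Suc_diff_Suc)
    then show ?case using Suc by auto
  qed
  show "w x = longest_perm N x"
  proof (cases "x \<in> {1..N}")
    case True
    then have "w x + (x - 1) \<le> N" "Suc (N - x) \<le> w x"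
      using up[of "x - 1"] low[of "N - x"] by auto
    then show ?thesis using True by (auto simp: longest_perm_def)
  next
    case False
    then show ?thesis using assms(1) by (auto simp: permutes_def longest_perm_def)
  qed
qed

lemma ex_ascent:
  assumes "w permutes {1..N}" "w \<noteq> longest_perm N"
  obtains i where "1 \<le> i" "i < N" "w i < w (Suc i)"
proof -
  obtain i where i: "1 \<le> i" "i < N" "\<not> w (Suc i) < w i"
    using decreasing_perm_eq_longest_perm[OF assms(1)] assms(2) by blast
  moreover have "w (Suc i) \<noteq> w i"
    using permutes_inj[OF assms(1)] by (metis injD n_not_Suc_n)
  ultimately show ?thesis using that by (metis linorder_neqE_nat)
qed

lemma perm_length_longest_perm: "perm_length (longest_perm N) = (\<Sum>i = 1..N. N - i)"
proof -
  have "inversions (longest_perm N) = pos_pairs N"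
    using inversions_subset_pos_pairs[OF longest_perm_permutes]
    by (auto simp: inversions_def pos_pairs_def longest_perm_def)
  then show ?thesis by (simp add: perm_length_def card_pos_pairs)
qed

lemma perm_length_less_longest_perm:
  assumes "v permutes {1..N}" "v \<noteq> longest_perm N"
  shows "perm_length v < perm_length (longest_perm N)"
proof -
  obtain i where "1 \<le> i" "i < N" "v i < v (Suc i)"
    using ex_ascent[OF assms] .
  then have "(i, Suc i) \<in> pos_pairs N - inversions v"
    by (auto simp: pos_pairs_def inversions_def)
  then have "inversions v \<subset> pos_pairs N"
    using inversions_subset_pos_pairs[OF assms(1)] by blast
  then have "card (inversions v) < card (pos_pairs N)"
    by (rule psubset_card_mono[OF finite_pos_pairs])
  then show ?thesis
    by (simp only: perm_length_longest_perm card_pos_pairs perm_length_def[of v])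
qed

lemma longest_monomial:
  defines "m \<equiv> \<lambda>N. \<Sum>j\<in>{1..N}. expo j (N - j)"
  shows "monomial_degree (m N) = perm_length (longest_perm N)" "m N \<in> staircase N"
proof -
  have deg: "monomial_degree (\<Sum>j\<in>A. expo j (e j)) = (\<Sum>j\<in>A. e j)" if "finite A" for A e
    using that by (induction A rule: finite_induct) (simp_all add: monomial_degree_add)
  then show "monomial_degree (m N) = perm_length (longest_perm N)"
    by (simp add: m_def perm_length_longest_perm)
  show "m N \<in> staircase N"
    by (auto simp: staircase_def m_def lookup_sum lookup_single when_def sum.delta)
qed

text \<open>Another v in S_N is too short and leaves a polynomial of positive degree; a v outside
  S_N annihilates the staircase.\<close>

lemma const_coeff_dd_perm_longest:
  assumes "v \<in> finitary_perms"
  shows "const_coeff (dd_perm v (\<Prod>i = 1..N. var i ^ (N - i))) = (if v = longest_perm N then 1 else 0)"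
proof (cases "v = longest_perm N")
  case True
  then show ?thesis by (simp only: dd_perm_longest_perm const_coeff_simps) simp
next
  case False
  let ?f = "\<Prod>i = 1..N. var i ^ (N - i)"
  have keys: "Poly_Mapping.keys ?f \<subseteq> {\<Sum>j\<in>{1..N}. expo j (N - j)}"
    by (simp add: prod_var_eq_single)
  show ?thesis
  proof (cases "v permutes {1..N}")
    case True
    have "Poly_Mapping.keys ?f \<subseteq> {m. monomial_degree m = perm_length (longest_perm N)}"
      using keys longest_monomial(1)[of N] by auto
    then show ?thesis
      using const_coeff_dd_perm_degree[OF assms] perm_length_less_longest_perm[OF True False] False
      by (metis nat_neq_iff)
  next
    case F: False
    have "Poly_Mapping.keys ?f \<subseteq> staircase N"
      using keys longest_monomial(2)[of N] by auto
    then show ?thesis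
      using dd_perm_staircase_eq_0[OF assms F] False by simp
  qed
qed

lemma keys_longest_staircase: "Poly_Mapping.keys (\<Prod>i = 1..N. var i ^ (N - i)) \<subseteq> staircase N"
  using longest_monomial(2)[of N] by (simp add: prod_var_eq_single)

text \<open>The adjoint form of a divided difference: it acts on the functionals indexed by v by
  lengthening v at an ascent and gives zero at a descent. Duality thereby follows the descent rule
  for Schubert polynomials.\<close>

lemma const_coeff_dd_perm_dd:
  assumes "v \<in> finitary_perms" "1 \<le> i"
  shows "const_coeff (dd_perm v (dd i f)) =
    (if v i < v (Suc i) then const_coeff (dd_perm (v \<circ> adj i) f) else 0)"
proof (cases "v i < v (Suc i)")
  case True
  then show ?thesis using dd_perm_asc[OF assms True] by simp
next
  case False
  then have "v (Suc i) < v i"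
    using finitary_perms_inj[OF assms(1), of i "Suc i"] by linarith
  then show ?thesis using dd_perm_desc[OF assms(1)] False by simp
qed

text \<open>Duality is what characterises f. The staircase support is carried along because the
  uniqueness argument needs variable 0 to be absent.\<close>

lemma schubert_rel_dual:
  assumes "schubert_rel w f"
  shows "w \<in> finitary_perms \<and> (\<exists>N. Poly_Mapping.keys f \<subseteq> staircase N) \<and>
    (\<forall>v\<in>finitary_perms. const_coeff (dd_perm v f) = (if v = w then 1 else 0))"
  using assms
proof (induction rule: schubert_rel.induct)
  case (longest N)
  show ?case
    using longest_perm_finitary keys_longest_staircase const_coeff_dd_perm_longest by blast
next
  case (descent w f i)
  have fin: "w \<circ> adj i \<in> finitary_perms"
    using descent finitary_perms_adj by simp
  have "const_coeff (dd_perm v (dd i f)) = (if v = w \<circ> adj i then 1 else 0)" if v: "v \<in> finitary_perms" for v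
  proof (cases "v i < v (Suc i)")
    case True
    have "v \<circ> adj i = w \<longleftrightarrow> v = w \<circ> adj i"
      by (auto simp: comp_assoc)
    then show ?thesis
      using True const_coeff_dd_perm_dd[OF v descent(2)] descent.IH finitary_perms_adj[OF v descent(2)]
      by metis
  next
    case False
    then have "v \<noteq> w \<circ> adj i" using descent(3) by auto
    then show ?thesis
      using False const_coeff_dd_perm_dd[OF v descent(2)] by simp
  qed
  then show ?case
    using fin descent.IH keys_dd_staircase descent(2) by (metis Suc_eq_plus1)
qed

text \<open>Induction downwards from the longest permutation: an ascent of w leads to a longer
  permutation of the same S_N, from which the descent rule returns to w.\<close>

lemma schubert_rel_exists:
  assumes "w \<in> finitary_perms"
  shows "\<exists>f. schubert_rel w f"
proof -
  obtain N where "w permutes {1..N}"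
    using assms by (auto simp: finitary_perms_def)
  then show ?thesis
    using assms
  proof (induction "perm_length (longest_perm N) - perm_length w" arbitrary: w rule: less_induct)
    case less
    show ?case
    proof (cases "w = longest_perm N")
      case True
      then show ?thesis using schubert_rel.longest by blast
    next
      case False
      obtain i where i: "1 \<le> i" "i < N" "w i < w (Suc i)"
        using ex_ascent[OF less.prems(1) False] .
      have perm: "(w \<circ> adj i) permutes {1..N}"
        using permutes_compose[OF adj_permutes[OF i(1,2)] less.prems(1)] .
      have "perm_length (longest_perm N) - perm_length (w \<circ> adj i) < perm_length (longest_perm N) - perm_length w"
        using perm_length_adj_asc[OF less.prems(2) i(1,3)] perm_length_less_longest_perm[OF less.prems(1) False]
        by linarith
      then obtain f where "schubert_rel (w \<circ> adj i) f"
        using less.hyps perm finitary_perms_adj[OF less.prems(2) i(1)] by blast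
      from schubert_rel.descent[OF this i(1)] i(3) show ?thesis
        by (auto simp: comp_assoc)
    qed
  qed
qed

text \<open>If x_j occurred, the symmetries would carry it to x_(j+1), x_(j+2) and so on, so that
  finitely many monomials would involve infinitely many variables.\<close>

lemma symmetric_imp_const:
  fixes f :: zpoly
  assumes sym: "\<And>i. 1 \<le> i \<Longrightarrow> swap_vars i f = f"
    and m: "m \<in> Poly_Mapping.keys f" "poly_mapping.lookup m 0 = 0"
  shows "m = 0"
proof (rule ccontr)
  assume "m \<noteq> 0"
  then obtain j where j: "poly_mapping.lookup m j \<noteq> 0"
    by (metis lookup_zero poly_mapping_eqI)
  then have "1 \<le> j" using m(2) by (cases j) auto
  have "\<exists>m'\<in>Poly_Mapping.keys f. poly_mapping.lookup m' (j + n) \<noteq> 0" for n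
  proof (induction n)
    case 0
    then show ?case using m(1) j by auto
  next
    case (Suc n)
    then obtain m' where m': "m' \<in> Poly_Mapping.keys f" "poly_mapping.lookup m' (j + n) \<noteq> 0" by blast
    have "swap_exps (j + n) m' \<in> Poly_Mapping.keys f"
      using m'(1) sym[of "j + n"] \<open>1 \<le> j\<close> by (metis in_keys_iff le_add1 le_trans lookup_swap_vars)
    moreover have "poly_mapping.lookup (swap_exps (j + n) m') (j + Suc n) \<noteq> 0"
      using m'(2) by (simp add: lookup_swap_exps)
    ultimately show ?case by blast
  qed
  then have "range (\<lambda>n. j + n) \<subseteq> (\<Union>m'\<in>Poly_Mapping.keys f. Poly_Mapping.keys m')"
    by (auto simp: in_keys_iff)
  then have "finite (range (\<lambda>n. j + n))"
    by (rule finite_subset) simp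
  then show False
    by (simp add: finite_image_iff)
qed

text \<open>Induction on a degree bound. Each \<open>dd i f\<close> has lower degree and again
  vanishing functionals, so it is 0. Then f is symmetric in all variables, hence constant, and the
  functional of \<open>id\<close> reads off this constant.\<close>

lemma zpoly_eq_0_if_dual_eq_0:
  assumes "Poly_Mapping.keys f \<subseteq> {m. poly_mapping.lookup m 0 = 0}"
    and "\<And>v. v \<in> finitary_perms \<Longrightarrow> const_coeff (dd_perm v f) = 0"
  shows "f = 0"
proof -
  have "f = 0" if "Poly_Mapping.keys f \<subseteq> {m. poly_mapping.lookup m 0 = 0 \<and> monomial_degree m < d}"
    "\<And>v. v \<in> finitary_perms \<Longrightarrow> const_coeff (dd_perm v f) = 0" for d f
    using that
  proof (induction d arbitrary: f)
    case 0
    then show ?case by simp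
  next
    case (Suc d)
    have "dd i f = 0" if i: "1 \<le> i" for i
    proof (rule Suc.IH)
      show "Poly_Mapping.keys (dd i f) \<subseteq> {m. poly_mapping.lookup m 0 = 0 \<and> monomial_degree m < d}"
        using i by (intro keys_dd[OF Suc.prems(1)])
          (auto simp: lookup_add lookup_single when_def monomial_degree_add)
      show "const_coeff (dd_perm v (dd i f)) = 0" if "v \<in> finitary_perms" for v
        using const_coeff_dd_perm_dd[OF that i] Suc.prems(2) finitary_perms_adj[OF that i] by metis
    qed
    then have sym: "swap_vars i f = f" if "1 \<le> i" for i
      using that by (simp add: swap_vars_eq_if_dd_eq_0)
    have "m = 0" if m: "m \<in> Poly_Mapping.keys f" for m
    proof (rule symmetric_imp_const[OF sym m])
      show "poly_mapping.lookup m 0 = 0" using Suc.prems(1) m by auto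
    qed
    moreover have "0 \<notin> Poly_Mapping.keys f"
      using Suc.prems(2)[OF id_finitary_perms] unfolding dd_perm_id const_coeff_def in_keys_iff by simp
    ultimately have "Poly_Mapping.keys f = {}" by blast
    then show ?case by simp
  qed
  moreover obtain d where "\<forall>m\<in>Poly_Mapping.keys f. monomial_degree m < d"
    using finite_nat_set_iff_bounded[of "monomial_degree ` Poly_Mapping.keys f"] by auto
  ultimately show ?thesis using assms by blast
qed

lemma schubert_rel_unique:
  assumes "schubert_rel w f" "schubert_rel w g"
  shows "f = g"
proof -
  have "f - g = 0"
  proof (rule zpoly_eq_0_if_dual_eq_0)
    show "Poly_Mapping.keys (f - g) \<subseteq> {m. poly_mapping.lookup m 0 = 0}"
      using schubert_rel_dual[OF assms(1)] schubert_rel_dual[OF assms(2)] keys_diff[of f g]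
      by (auto simp: staircase_def)
    show "const_coeff (dd_perm v (f - g)) = 0" if "v \<in> finitary_perms" for v
      using that schubert_rel_dual[OF assms(1)] schubert_rel_dual[OF assms(2)]
      by (simp add: dd_perm_diff)
  qed
  then show ?thesis by simp
qed

theorem schubert_dual:
  assumes "v \<in> finitary_perms" "w \<in> finitary_perms"
  shows "const_coeff (dd_perm v (schubert w)) = (if v = w then 1 else 0)"
proof -
  have "schubert_rel w (schubert w)"
    unfolding schubert_def using schubert_rel_exists[OF assms(2)] schubert_rel_unique by (metis theI)
  then show ?thesis using schubert_rel_dual assms(1) by blast
qed

section \<open>Complete homogeneous and two-row Schur polynomials\<close>

definition msets_of_size :: "'a set \<Rightarrow> nat \<Rightarrow> 'a multiset set" where
  "msets_of_size I m = {M. size M = m \<and> set_mset M \<subseteq> I}"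

text \<open>The complete homogeneous polynomial h_m in the variables indexed by I. Arbitrary index
  sets occur because divided differences lead from {1..k} to other sets.\<close>

definition complete_hom :: "nat set \<Rightarrow> nat \<Rightarrow> zpoly" where
  "complete_hom I m = (\<Sum>M\<in>msets_of_size I m. \<Prod>x\<in>#M. var x)"

lemma finite_msets_of_size: "finite I \<Longrightarrow> finite (msets_of_size I m)"
proof -
  assume "finite I"
  have "msets_of_size I m \<subseteq> mset ` {xs. set xs \<subseteq> I \<and> length xs = m}"
  proof
    fix M assume "M \<in> msets_of_size I m"
    moreover obtain xs where "mset xs = M" using ex_mset by blast
    ultimately show "M \<in> mset ` {xs. set xs \<subseteq> I \<and> length xs = m}"
      by (auto simp: msets_of_size_def)
  qed
  then show ?thesis
    by (rule finite_subset) (intro finite_imageI finite_lists_length_eq \<open>finite I\<close>)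
qed

lemma complete_hom_0 [simp]: "complete_hom I 0 = 1"
proof -
  have "msets_of_size I 0 = {{#}}" by (auto simp: msets_of_size_def)
  then show ?thesis by (simp add: complete_hom_def)
qed

lemma complete_hom_insert:
  assumes "finite I" "i \<notin> I"
  shows "complete_hom (insert i I) (Suc m) = complete_hom I (Suc m) + var i * complete_hom (insert i I) m"
proof -
  have split: "msets_of_size (insert i I) (Suc m) =
      msets_of_size I (Suc m) \<union> add_mset i ` msets_of_size (insert i I) m"
  proof (intro equalityI subsetI)
    fix M assume M: "M \<in> msets_of_size (insert i I) (Suc m)"
    show "M \<in> msets_of_size I (Suc m) \<union> add_mset i ` msets_of_size (insert i I) m"
    proof (cases "i \<in># M")
      case True
      then obtain M' where "M = add_mset i M'" by (meson multi_member_split)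
      then show ?thesis using M by (auto simp: msets_of_size_def)
    next
      case False
      then show ?thesis using M by (auto simp: msets_of_size_def)
    qed
  qed (auto simp: msets_of_size_def)
  have "msets_of_size I (Suc m) \<inter> add_mset i ` msets_of_size (insert i I) m = {}"
    using assms(2) by (auto simp: msets_of_size_def)
  then have "complete_hom (insert i I) (Suc m) =
      complete_hom I (Suc m) + (\<Sum>M\<in>add_mset i ` msets_of_size (insert i I) m. \<Prod>x\<in>#M. var x)"
    unfolding complete_hom_def split using assms(1)
    by (intro sum.union_disjoint) (auto intro: finite_msets_of_size)
  also have "(\<Sum>M\<in>add_mset i ` msets_of_size (insert i I) m. \<Prod>x\<in>#M. var x) = var i * complete_hom (insert i I) m"
    by (subst sum.reindex) (auto simp: inj_on_def complete_hom_def sum_distrib_left)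
  finally show ?thesis .
qed

lemma swap_vars_prod_mset: "swap_vars i (\<Prod>x\<in>#M. f x) = (\<Prod>x\<in>#M. swap_vars i (f x))"
  by (induction M) (simp_all add: swap_vars_mult)

lemma swap_vars_complete_hom: "swap_vars i (complete_hom I m) = complete_hom (adj i ` I) m"
proof -
  have inj: "inj_on (image_mset (adj i)) (msets_of_size I m)"
    by (rule inj_onI) (metis (no_types, lifting) comp_apply multiset.map_comp multiset.map_id0
        transpose_comp_involutory id_apply)
  have img: "image_mset (adj i) ` msets_of_size I m = msets_of_size (adj i ` I) m"
  proof (intro equalityI subsetI)
    fix M assume M: "M \<in> msets_of_size (adj i ` I) m"
    have "M = image_mset (adj i) (image_mset (adj i) M)"
      by (simp add: multiset.map_comp comp_def)
    moreover have "image_mset (adj i) M \<in> msets_of_size I m"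
      using M by (auto simp: msets_of_size_def)
    ultimately show "M \<in> image_mset (adj i) ` msets_of_size I m" by blast
  qed (auto simp: msets_of_size_def intro!: imageI)
  show ?thesis
    unfolding complete_hom_def img[symmetric] sum.reindex[OF inj]
    by (simp add: swap_vars_sum swap_vars_prod_mset multiset.map_comp comp_def)
qed

text \<open>The polynomial h_(m+1) in the variables of I together with x_(i+1) is expanded twice,
  splitting off x_(i+1) or x_i; the difference of the two expansions exhibits the quotient.\<close>

lemma dd_complete_hom:
  assumes "finite I" "i \<in> I" "Suc i \<notin> I"
  shows "dd i (complete_hom I (Suc m)) = complete_hom (insert (Suc i) I) m"
proof (rule dd_unique)
  define J where "J = I - {i}"
  have J: "I = insert i J" "i \<notin> J" "Suc i \<notin> J" "finite J"
    using assms by (auto simp: J_def)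
  have "adj i ` J = J"
    using J(2,3) by (auto simp: image_iff transpose_def)
  then have adjI: "adj i ` I = insert (Suc i) J"
    by (simp add: J)
  have "complete_hom (insert (Suc i) (insert i J)) (Suc m) =
      complete_hom I (Suc m) + var (Suc i) * complete_hom (insert (Suc i) I) m"
    using complete_hom_insert[of "insert i J" "Suc i" m] J assms by simp
  moreover have "complete_hom (insert (Suc i) (insert i J)) (Suc m) =
      complete_hom (insert (Suc i) J) (Suc m) + var i * complete_hom (insert (Suc i) I) m"
    using complete_hom_insert[of "insert (Suc i) J" i m] J by (simp add: insert_commute)
  ultimately show "(var i - var (Suc i)) * complete_hom (insert (Suc i) I) m =
      complete_hom I (Suc m) - swap_vars i (complete_hom I (Suc m))"
    by (simp add: swap_vars_complete_hom adjI algebra_simps)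
qed

lemma dd_complete_hom_mult:
  "dd i (complete_hom I m * f) = dd i (complete_hom I m) * f + complete_hom (adj i ` I) m * dd i f"
  by (simp add: dd_mult swap_vars_complete_hom)

lemma const_coeff_complete_hom_mult:
  "const_coeff (complete_hom I m * f) = (if m = 0 then const_coeff f else 0)"
proof (cases "m = 0")
  case False
  have "const_coeff ((\<Prod>x\<in>#M. var x) * f) = 0" if M: "M \<in> msets_of_size I m" for M
  proof -
    have "M \<noteq> {#}" using M False by (auto simp: msets_of_size_def)
    then obtain x M' where "M = add_mset x M'" by (meson multiset_cases)
    then show ?thesis by (simp add: mult.assoc)
  qed
  then show ?thesis
    using False by (simp add: complete_hom_def sum_distrib_right const_coeff_sum)
qed simp

section \<open>Two-row tableaux and the Jacobi--Trudi identity\<close>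

definition sorted_lists :: "nat \<Rightarrow> nat \<Rightarrow> nat list set" where
  "sorted_lists k m = {xs. length xs = m \<and> sorted xs \<and> set xs \<subseteq> {1..k}}"

lemma finite_sorted_lists: "finite (sorted_lists k m)"
  using finite_lists_length_eq[of "{1..k}" m]
  by (rule rev_finite_subset) (auto simp: sorted_lists_def)

lemma prod_list_var_eq_prod_mset: "(\<Prod>x\<leftarrow>xs. var x) = (\<Prod>x\<in>#mset xs. var x)"
  by (induction xs) simp_all

lemma complete_hom_sorted_lists:
  "complete_hom {1..k} m = (\<Sum>xs\<in>sorted_lists k m. \<Prod>x\<leftarrow>xs. var x)"
  unfolding complete_hom_def
  by (rule sum.reindex_bij_witness[of _ mset sorted_list_of_multiset])
    (auto simp: sorted_lists_def msets_of_size_def sorted_sort_id prod_list_var_eq_prod_mset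
      simp flip: size_mset set_mset_mset)

lemma sorted_take_drop:
  fixes xs ys :: "nat list"
  assumes "sorted xs" "sorted ys" "p \<le> length xs"
    and "0 < p \<Longrightarrow> q < length ys \<Longrightarrow> xs ! (p - 1) \<le> ys ! q"
  shows "sorted (take p xs @ drop q ys)"
proof -
  have "x \<le> y" if xy: "x \<in> set (take p xs)" "y \<in> set (drop q ys)" for x y
  proof -
    obtain i where i: "i < p" "x = xs ! i" "i < length xs"
      using xy(1) by (auto simp: in_set_conv_nth)
    obtain j where j: "y = ys ! (q + j)" "q + j < length ys"
      using xy(2) by (auto simp: in_set_conv_nth)
    have "x \<le> xs ! (p - 1)"
      using i assms(1,3) by (auto intro: sorted_nth_mono)
    also have "\<dots> \<le> ys ! q" using assms(4) i j by auto
    also have "\<dots> \<le> y" using j assms(2) by (auto intro: sorted_nth_mono)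
    finally show ?thesis .
  qed
  then show ?thesis
    using assms(1,2) by (auto simp: sorted_append sorted_wrt_take sorted_wrt_drop)
qed

lemma young_diagram_two_rows:
  "young_diagram [a, b] = Pair 0 ` {..<a} \<union> Pair 1 ` {..<b}"
  by (auto simp: young_diagram_def less_Suc_eq numeral_2_eq_2)

definition strict_rows :: "nat \<Rightarrow> nat \<Rightarrow> nat \<Rightarrow> (nat list \<times> nat list) set" where
  "strict_rows k a b =
    {(xs, ys). xs \<in> sorted_lists k a \<and> ys \<in> sorted_lists k b \<and> (\<forall>c<b. xs ! c < ys ! c)}"

lemma schur_two_rows:
  assumes "b \<le> a"
  shows "schur k [a, b] = (\<Sum>(xs, ys)\<in>strict_rows k a b. (\<Prod>x\<leftarrow>xs. var x) * (\<Prod>y\<leftarrow>ys. var y))"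
proof -
  let ?D = "young_diagram [a, b]"
  have mem: "(r, c) \<in> ?D \<longleftrightarrow> (r = 0 \<and> c < a) \<or> (r = 1 \<and> c < b)" for r c
    by (auto simp: young_diagram_two_rows)
  define rows where "rows T = (map (\<lambda>c. T (0::nat, c)) [0..<a], map (\<lambda>c. T (1::nat, c)) [0..<b])"
    for T :: "nat \<times> nat \<Rightarrow> nat"
  define fill where "fill = (\<lambda>(xs :: nat list, ys :: nat list). \<lambda>(r, c). if (r, c) \<in> ?D then (if r = 0 then xs ! c else ys ! c) else undefined)"
  have prod: "(\<Prod>c\<in>?D. var (T c)) = (\<Prod>x\<leftarrow>fst (rows T). var x) * (\<Prod>y\<leftarrow>snd (rows T). var y)" for T
  proof -
    have "(\<Prod>c\<in>?D. var (T c)) = (\<Prod>c\<in>Pair 0 ` {..<a}. var (T c)) * (\<Prod>c\<in>Pair 1 ` {..<b}. var (T c))"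
      unfolding young_diagram_two_rows by (rule prod.union_disjoint) auto
    moreover have "(\<Prod>c\<in>Pair r ` {..<n}. var (T c)) = (\<Prod>x\<leftarrow>map (\<lambda>c. T (r, c)) [0..<n]. var x)" for r n
      by (subst prod.reindex) (auto simp: inj_on_def prod.list_conv_set_nth comp_def atLeast0LessThan)
    ultimately show ?thesis by (simp add: rows_def)
  qed
  show ?thesis
    unfolding schur_def
  proof (rule sum.reindex_bij_witness[of _ fill rows])
    fix T assume T: "T \<in> ssyt k [a, b]"
    then have img: "T \<in> ?D \<rightarrow>\<^sub>E {1..k}"
      and row: "\<And>r c. (r, c + 1) \<in> ?D \<Longrightarrow> T (r, c) \<le> T (r, c + 1)"
      and col: "\<And>r c. (r + 1, c) \<in> ?D \<Longrightarrow> T (r, c) < T (r + 1, c)"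
      by (auto simp: ssyt_def)
    show "fill (rows T) = T"
      using img by (auto simp: fill_def rows_def fun_eq_iff mem PiE_def extensional_def)
    have "sorted (map (\<lambda>c. T (0, c)) [0..<a])"
      using row[of 0] by (auto simp: sorted_iff_nth_Suc mem)
    moreover have "sorted (map (\<lambda>c. T (Suc 0, c)) [0..<b])"
      using row[of 1] by (auto simp: sorted_iff_nth_Suc mem)
    moreover have "T (0, c) \<in> {1..k}" if "c < a" for c
      using img mem that by blast
    moreover have "T (Suc 0, c) \<in> {1..k}" if "c < b" for c
      using img mem that by (metis One_nat_def PiE_mem)
    ultimately show "rows T \<in> strict_rows k a b"
      using col[of 0] assms by (fastforce simp: rows_def strict_rows_def sorted_lists_def mem)
    show "(case rows T of (xs, ys) \<Rightarrow> (\<Prod>x\<leftarrow>xs. var x) * (\<Prod>y\<leftarrow>ys. var y)) = (\<Prod>c\<in>?D. var (T c))"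
      by (simp add: prod split: prod.split)
  next
    fix p assume "p \<in> strict_rows k a b"
    then obtain xs ys where p: "p = (xs, ys)" "xs \<in> sorted_lists k a" "ys \<in> sorted_lists k b"
      "\<And>c. c < b \<Longrightarrow> xs ! c < ys ! c"
      by (auto simp: strict_rows_def)
    have len: "length xs = a" "length ys = b"
      using p by (auto simp: sorted_lists_def)
    have rng: "xs ! c \<in> {1..k}" if "c < a" for c
      using p(2) that by (auto simp: sorted_lists_def dest!: subsetD[OF _ nth_mem])
    have rng': "ys ! c \<in> {1..k}" if "c < b" for c
      using p(3) that by (auto simp: sorted_lists_def dest!: subsetD[OF _ nth_mem])
    show "rows (fill p) = p"
      by (auto simp: p(1) fill_def rows_def mem len intro!: nth_equalityI)
    have "fill p \<in> ?D \<rightarrow>\<^sub>E {1..k}"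
      using rng rng' by (auto simp: p(1) fill_def mem PiE_def extensional_def)
    moreover have "fill p (r, c) \<le> fill p (r, c + 1)" if "(r, c + 1) \<in> ?D" for r c
      using that p(2,3) by (auto simp: p(1) fill_def mem sorted_lists_def sorted_iff_nth_Suc)
    moreover have "fill p (r, c) < fill p (r + 1, c)" if "(r + 1, c) \<in> ?D" for r c
      using that p(4) assms by (auto simp: p(1) fill_def mem)
    ultimately show "fill p \<in> ssyt k [a, b]"
      by (auto simp: ssyt_def)
  qed
qed

text \<open>
  The two-row Jacobi--Trudi identity: swapping the tails of two rows at their first violation of
  column strictness pairs off the non-tableaux with all pairs of rows of lengths \<open>a + 1, b\<close>.
\<close>

lemma schur_two_rows_plus:
  assumes "Suc b \<le> a"
  shows "schur k [a, Suc b] + complete_hom {1..k} (Suc a) * complete_hom {1..k} b =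
    complete_hom {1..k} a * complete_hom {1..k} (Suc b)"
proof -
  let ?L = "sorted_lists k"
  define wt where "wt = (\<lambda>(xs, ys). (\<Prod>x\<leftarrow>xs. var x) * (\<Prod>y\<leftarrow>ys. var y))"
  define nonstrict where "nonstrict = ?L a \<times> ?L (Suc b) - strict_rows k a (Suc b)"
  define viol where "viol = (\<lambda>(xs :: nat list, ys). LEAST c. c < Suc b \<and> ys ! c \<le> xs ! c)"
  \<comment> \<open>The alternative c = b stops the search at the end of the shorter row, so a cut
    always exists.\<close>
  define viol' where "viol' = (\<lambda>(xs :: nat list, ys). LEAST c. c = b \<or> xs ! c \<le> ys ! c)"
  \<comment> \<open>The rows are cut after c + 1 and after c entries, so the swap transfers one
    cell: lengths a, b + 1 become a + 1, b.\<close>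
  define \<phi> where "\<phi> = (\<lambda>(xs, ys). let c = viol (xs, ys) in
    (take (Suc c) ys @ drop c xs, take c xs @ drop (Suc c) ys))"
  define \<psi> where "\<psi> = (\<lambda>(xs, ys). let c = viol' (xs, ys) in
    (take c ys @ drop (Suc c) xs, take (Suc c) xs @ drop c ys))"
  have set_sub: "set (take p xs @ drop q ys) \<subseteq> {1..k}" if "set xs \<subseteq> {1..k}" "set ys \<subseteq> {1..k}"
    for p q xs ys
    using that set_take_subset[of p xs] set_drop_subset[of q ys] by auto
  have bij: "\<psi> p = q \<and> q \<in> nonstrict \<and> wt q = wt p \<and> \<phi> q = p" if "p \<in> ?L (Suc a) \<times> ?L b" "q = \<psi> p" for p q
  proof -
    obtain A B where p: "p = (A, B)" by (cases p)
    have AB: "length A = Suc a" "length B = b" "sorted A" "sorted B" "set A \<subseteq> {1..k}" "set B \<subseteq> {1..k}"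
      using that(1) by (auto simp: p sorted_lists_def)
    define c where "c = viol' (A, B)"
    have c: "c = b \<or> A ! c \<le> B ! c"
      unfolding c_def viol'_def prod.case by (rule LeastI[where k = b]) simp
    have cb: "c \<le> b"
      unfolding c_def viol'_def prod.case by (rule Least_le) simp
    have lt: "B ! j < A ! j" if "j < c" for j
      using not_less_Least[of j "\<lambda>c. c = b \<or> A ! c \<le> B ! c"] that
      unfolding c_def viol'_def prod.case by auto
    define xs ys where "xs = take c B @ drop (Suc c) A" and "ys = take (Suc c) A @ drop c B"
    have q: "q = (xs, ys)"
      by (simp add: that(2) p \<psi>_def c_def[symmetric] xs_def ys_def Let_def)
    have len: "length xs = a" "length ys = Suc b"
      using AB(1,2) cb assms by (auto simp: xs_def ys_def)
    have "sorted xs"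
      unfolding xs_def
    proof (rule sorted_take_drop)
      assume "0 < c" "Suc c < length A"
      then show "B ! (c - 1) \<le> A ! Suc c"
        using lt[of "c - 1"] sorted_nth_mono[OF AB(3), of "c - 1" "Suc c"] by linarith
    qed (use AB cb in auto)
    moreover have "sorted ys"
      unfolding ys_def by (rule sorted_take_drop) (use AB c cb assms in auto)
    ultimately have LL: "xs \<in> ?L a" "ys \<in> ?L (Suc b)"
      using len set_sub[OF AB(6,5)] set_sub[OF AB(5,6)] by (auto simp: sorted_lists_def xs_def ys_def)
    have xs_nth: "xs ! j = B ! j" if "j < c" for j
      using that AB cb by (simp add: xs_def nth_append)
    have ys_nth: "ys ! j = A ! j" if "j \<le> c" for j
      using that AB cb assms by (simp add: ys_def nth_append)
    \<comment> \<open>After the swap the two entries of column c are neighbours in the old first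
      row, which makes c the first violation.\<close>
    have "xs ! c = A ! Suc c"
      using AB cb assms by (simp add: xs_def nth_append)
    then have vc: "ys ! c \<le> xs ! c"
      using ys_nth[of c] sorted_nth_mono[OF AB(3), of c "Suc c"] AB cb assms by auto
    then have "q \<in> nonstrict"
      using LL cb by (auto simp: nonstrict_def q strict_rows_def not_less intro!: exI[of _ c])
    moreover have viol: "viol (xs, ys) = c"
      unfolding viol_def prod.case
    proof (rule Least_equality)
      show "c < Suc b \<and> ys ! c \<le> xs ! c" using cb vc by simp
      show "c \<le> j" if "j < Suc b \<and> ys ! j \<le> xs ! j" for j
        using that lt[of j] xs_nth[of j] ys_nth[of j] by (cases "j < c") auto
    qed
    moreover have "\<phi> q = p"
    proof -
      have "\<phi> q = (take (Suc c) ys @ drop c xs, take c xs @ drop (Suc c) ys)"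
        by (simp add: q \<phi>_def viol Let_def)
      moreover have "take (Suc c) ys @ drop c xs = A" "take c xs @ drop (Suc c) ys = B"
        using AB cb assms by (simp_all add: xs_def ys_def min_def)
      ultimately show ?thesis by (simp only: p)
    qed
    moreover have "wt q = wt p"
    proof -
      have td: "mset (take j X) + mset (drop j X) = mset X" for j and X :: "nat list"
        by (simp flip: mset_append)
      have "mset xs + mset ys =
          (mset (take (Suc c) A) + mset (drop (Suc c) A)) + (mset (take c B) + mset (drop c B))"
        unfolding xs_def ys_def mset_append by (simp only: add_ac)
      then have "mset xs + mset ys = mset A + mset B"
        by (simp only: td)
      then have "(\<Prod>x\<in>#mset xs + mset ys. var x) = (\<Prod>x\<in>#mset A + mset B. var x)" by simp
      then show ?thesis
        by (simp add: wt_def q p prod_list_var_eq_prod_mset)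
    qed
    ultimately show ?thesis using that(2) by simp
  qed
  have bij': "\<phi> p \<in> ?L (Suc a) \<times> ?L b \<and> \<psi> (\<phi> p) = p" if "p \<in> nonstrict" for p
  proof -
    obtain xs ys where p: "p = (xs, ys)" by (cases p)
    have XY: "length xs = a" "length ys = Suc b" "sorted xs" "sorted ys" "set xs \<subseteq> {1..k}" "set ys \<subseteq> {1..k}"
      using that by (auto simp: p sorted_lists_def nonstrict_def)
    define c where "c = viol (xs, ys)"
    have ex: "\<exists>c. c < Suc b \<and> ys ! c \<le> xs ! c"
      using that by (auto simp: p nonstrict_def strict_rows_def not_less)
    have c: "c < Suc b" "ys ! c \<le> xs ! c"
      using LeastI_ex[OF ex] unfolding c_def viol_def prod.case by auto
    have lt: "xs ! j < ys ! j" if "j < c" for j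
      using not_less_Least[of j "\<lambda>c. c < Suc b \<and> ys ! c \<le> xs ! c"] that c(1)
      unfolding c_def viol_def prod.case by auto
    define A B where "A = take (Suc c) ys @ drop c xs" and "B = take c xs @ drop (Suc c) ys"
    have q: "\<phi> p = (A, B)"
      by (simp add: p \<phi>_def c_def[symmetric] A_def B_def Let_def)
    have len: "length A = Suc a" "length B = b"
      using XY(1,2) c assms by (auto simp: A_def B_def)
    have "sorted B"
      unfolding B_def
    proof (rule sorted_take_drop)
      assume "0 < c" "Suc c < length ys"
      then show "xs ! (c - 1) \<le> ys ! Suc c"
        using lt[of "c - 1"] sorted_nth_mono[OF XY(4), of "c - 1" "Suc c"] by linarith
    qed (use XY c assms in auto)
    moreover have "sorted A"
      unfolding A_def by (rule sorted_take_drop) (use XY c assms in auto)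
    ultimately have LL: "A \<in> ?L (Suc a)" "B \<in> ?L b"
      using len set_sub[OF XY(6,5)] set_sub[OF XY(5,6)] by (auto simp: sorted_lists_def A_def B_def)
    have A_nth: "A ! j = ys ! j" if "j \<le> c" for j
      using that XY c by (simp add: A_def nth_append)
    have B_nth: "B ! j = xs ! j" if "j < c" for j
      using that XY c assms by (simp add: B_def nth_append)
    have Bc: "A ! c \<le> B ! c" if "c < b"
      using that A_nth[of c] XY c assms sorted_nth_mono[OF XY(4), of c "Suc c"]
      by (simp add: B_def nth_append)
    have viol': "viol' (A, B) = c"
      unfolding viol'_def prod.case
    proof (rule Least_equality)
      show "c = b \<or> A ! c \<le> B ! c" using c(1) Bc by (cases "c < b") auto
      show "c \<le> j" if "j = b \<or> A ! j \<le> B ! j" for j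
        using that lt[of j] A_nth[of j] B_nth[of j] c(1) by (cases "j < c") auto
    qed
    have "\<psi> (A, B) = (take c B @ drop (Suc c) A, take (Suc c) A @ drop c B)"
      by (simp add: \<psi>_def viol' Let_def)
    moreover have "take c B @ drop (Suc c) A = xs" "take (Suc c) A @ drop c B = ys"
      using XY c assms by (simp_all add: A_def B_def min_def)
    ultimately have "\<psi> (\<phi> p) = p" unfolding q by (simp only: p)
    then show ?thesis using LL q by simp
  qed
  have "(\<Sum>p\<in>nonstrict. wt p) = (\<Sum>p\<in>?L (Suc a) \<times> ?L b. wt p)"
  proof (rule sum.reindex_bij_witness[of _ \<psi> \<phi>])
    fix p assume "p \<in> nonstrict"
    from bij'[OF this] show "\<psi> (\<phi> p) = p" "\<phi> p \<in> ?L (Suc a) \<times> ?L b" by blast+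
    then show "wt (\<phi> p) = wt p" using bij[of "\<phi> p" p] by simp
  next
    fix p assume "p \<in> ?L (Suc a) \<times> ?L b"
    from bij[OF this refl] show "\<phi> (\<psi> p) = p" "\<psi> p \<in> nonstrict" by blast+
  qed
  moreover have "(\<Sum>p\<in>?L a \<times> ?L (Suc b). wt p) = (\<Sum>p\<in>nonstrict. wt p) + (\<Sum>p\<in>strict_rows k a (Suc b). wt p)"
  proof -
    have "strict_rows k a (Suc b) \<subseteq> ?L a \<times> ?L (Suc b)" by (auto simp: strict_rows_def)
    then show ?thesis
      unfolding nonstrict_def by (intro sum.subset_diff) (auto simp: finite_sorted_lists)
  qed
  moreover have "(\<Sum>p\<in>?L m \<times> ?L n. wt p) = complete_hom {1..k} m * complete_hom {1..k} n" for m n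
    unfolding complete_hom_sorted_lists sum_product sum.cartesian_product wt_def ..
  moreover have "schur k [a, Suc b] = (\<Sum>p\<in>strict_rows k a (Suc b). wt p)"
    unfolding wt_def by (rule schur_two_rows[OF assms])
  ultimately show ?thesis
    by (simp only: add.commute)
qed

section \<open>Block steps\<close>

text \<open>
  \<open>block_step I l h r\<close>: the permutation \<open>h\<close> arises from \<open>l\<close> by cyclically shifting values within
  blocks, the block of a position \<open>c\<close> being labelled \<open>r c\<close>.  A nontrivial block contains exactly one
  position from \<open>I\<close>, its label, which jumps from the smallest to the largest value of the block; every
  other position of the block drops to the next smaller value.
\<close>

definition block_step :: "nat set \<Rightarrow> (nat \<Rightarrow> nat) \<Rightarrow> (nat \<Rightarrow> nat) \<Rightarrow> (nat \<Rightarrow> nat) \<Rightarrow> bool" where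
  "block_step I l h r \<longleftrightarrow>
     (\<forall>a\<in>I. r a = a) \<and>
     (\<forall>c d. l c = h d \<longrightarrow> r c = r d) \<and>
     (\<forall>b. b \<notin> I \<longrightarrow> h b \<le> l b \<and> (\<forall>c. r c = r b \<longrightarrow> \<not> (h b < l c \<and> l c < l b))) \<and>
     (\<forall>a\<in>I. \<forall>c. r c = a \<longrightarrow> l a \<le> l c \<and> l c \<le> h a) \<and>
     (\<forall>b. b \<notin> I \<longrightarrow> (if h b = l b then r b = b else r b \<in> I))"

text \<open>Read through the values of h, the blocks of r form a noncrossing partition.\<close>

definition noncrossing :: "(nat \<Rightarrow> nat) \<Rightarrow> (nat \<Rightarrow> nat) \<Rightarrow> bool" where
  "noncrossing h r \<longleftrightarrow> (\<forall>c d c' d'. r c = r c' \<longrightarrow> r d = r d' \<longrightarrow>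
     h c < h d \<longrightarrow> h d < h c' \<longrightarrow> h c' < h d' \<longrightarrow> r c = r d)"

lemma block_stepD:
  assumes "block_step I l h r"
  shows block_step_label: "a \<in> I \<Longrightarrow> r a = a"
    and block_step_same: "l c = h d \<Longrightarrow> r c = r d"
    and block_step_drop: "b \<notin> I \<Longrightarrow> h b \<le> l b"
    and block_step_gap: "b \<notin> I \<Longrightarrow> r c = r b \<Longrightarrow> h b < l c \<Longrightarrow> l c < l b \<Longrightarrow> False"
    and block_step_min: "a \<in> I \<Longrightarrow> r c = a \<Longrightarrow> l a \<le> l c"
    and block_step_max: "a \<in> I \<Longrightarrow> r c = a \<Longrightarrow> l c \<le> h a"
    and block_step_fix: "b \<notin> I \<Longrightarrow> h b = l b \<Longrightarrow> r b = b"
    and block_step_moved: "b \<notin> I \<Longrightarrow> h b \<noteq> l b \<Longrightarrow> r b \<in> I"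
  using assms unfolding block_step_def by (blast, blast, blast, blast, blast, blast, metis, metis)

text \<open>By \<open>block_step_same\<close> both permutations induce the same labelling of values,
  so a crossing seen through l would also be one through h.\<close>

lemma noncrossing_lower:
  assumes "block_step I l h r" "surj h" "noncrossing h r"
  shows "noncrossing l r"
  unfolding noncrossing_def
proof (intro allI impI)
  fix c d c' d'
  assume *: "r c = r c'" "r d = r d'" "l c < l d" "l d < l c'" "l c' < l d'"
  have "\<exists>x'. h x' = l x \<and> r x' = r x" for x
    using assms(1,2) block_step_same by (metis surjD)
  then obtain e f e' f' where "h e = l c" "r e = r c" "h f = l d" "r f = r d"
    "h e' = l c'" "r e' = r c'" "h f' = l d'" "r f' = r d'" by metis
  with * assms(3) show "r c = r d"
    unfolding noncrossing_def by metis
qed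

text \<open>Two candidates u and u' for the permutation between w and v, moving the same positions
  outside I in the first step. X will be the largest value that they place differently. The
  arguments climb from a value to larger ones, where everything is already known to agree.\<close>

context
  fixes I :: "nat set" and w u u' v r r' s s' :: "nat \<Rightarrow> nat" and X M :: nat
  assumes perms: "w permutes {1..M}" "u permutes {1..M}" "u' permutes {1..M}" "v permutes {1..M}"
    and step_u: "block_step I w u r" "noncrossing w r"
    and step_u': "block_step I w u' r'" "noncrossing w r'"
    and step_v: "block_step I u v s" "block_step I u' v s'"
    and same_drops: "\<And>b. b \<notin> I \<Longrightarrow> u b = w b \<longleftrightarrow> u' b = w b"
    and agree: "\<And>c. X < u c \<or> X < u' c \<Longrightarrow> u c = u' c"
begin

text \<open>Follow T to its position d in v. If d is a label, or held T in both u and u', the two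
  labels are d. Otherwise d held a larger value, the same in u and u', and the claim for that value
  transfers. Values above M are fixed, so the climb ends.\<close>

lemma second_labels_agree:
  assumes "X \<le> T" "u c = T" "u' c' = T"
  shows "s c = s' c'"
  using assms
proof (induction "Suc M - T" arbitrary: T c c' rule: less_induct)
  case less
  obtain d where d: "v d = T" using permutes_surj[OF perms(4)] by (metis surjD)
  have sc: "s c = s d" "s' c' = s' d"
    using block_step_same[OF step_v(1)] block_step_same[OF step_v(2)] less.prems d by metis+
  have "s d = s' d"
  proof (cases "d \<in> I")
    case True
    then show ?thesis using block_step_label[OF step_v(1)] block_step_label[OF step_v(2)] by simp
  next
    case False
    then have ge: "T \<le> u d" "T \<le> u' d"
      using block_step_drop[OF step_v(1)] block_step_drop[OF step_v(2)] d by metis+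
    show ?thesis
    proof (cases "u d = T \<and> u' d = T")
      case True
      then show ?thesis
        using block_step_fix[OF step_v(1) False] block_step_fix[OF step_v(2) False] d by simp
    next
      case F: False
      then have eq: "u d = u' d" "T < u d"
        using ge agree[of d] less.prems(1) by linarith+
      have "T \<le> M"
      proof (rule ccontr)
        assume "\<not> T \<le> M"
        then have "v T = T" using perms(4) by (auto simp: permutes_def)
        then have "d = T" using d permutes_inj[OF perms(4)] by (metis injD)
        then show False using eq \<open>\<not> T \<le> M\<close> perms(2) by (auto simp: permutes_def)
      qed
      then have "Suc M - u d < Suc M - T" "X \<le> u d"
        using eq(2) less.prems(1) by linarith+
      from less.hyps[OF this refl eq(1)[symmetric]] show ?thesis .
    qed
  qed
  with sc show ?case by simp
qed

text \<open>The same climb in the first step: a dropped position c shares its block with the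
  position that carries the larger value \<open>w c\<close> in u.\<close>

lemma first_labels_agree:
  assumes "X < u c"
  shows "r c = r' c"
  using assms
proof (induction "Suc M - u c" arbitrary: c rule: less_induct)
  case less
  have uc: "u' c = u c" using agree less.prems by metis
  show ?case
  proof (cases "c \<in> I")
    case True
    then show ?thesis using block_step_label[OF step_u(1)] block_step_label[OF step_u'(1)] by simp
  next
    case False
    show ?thesis
    proof (cases "w c = u c")
      case True
      then show ?thesis
        using block_step_fix[OF step_u(1) False] block_step_fix[OF step_u'(1) False] uc by simp
    next
      case F: False
      then have lt: "u c < w c" using block_step_drop[OF step_u(1) False] by simp
      obtain e where e: "u e = w c" using permutes_surj[OF perms(2)] by (metis surjD)
      have "u' e = w c" using agree[of e] e lt less.prems by auto
      then have re: "r c = r e" "r' c = r' e"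
        using block_step_same[OF step_u(1)] block_step_same[OF step_u'(1)] e by metis+
      have "w c \<le> M"
      proof (rule ccontr)
        assume "\<not> w c \<le> M"
        then have "c \<notin> {1..M}" using permutes_in_image[OF perms(1), of c] by auto
        then show False using F perms(1,2) by (auto simp: permutes_def)
      qed
      then have "Suc M - u e < Suc M - u c" "X < u e"
        using lt less.prems unfolding e by linarith+
      then have "r e = r' e" by (rule less.hyps)
      with re show ?thesis by simp
    qed
  qed
qed

text \<open>Otherwise b drops past X in the step to u and exactly to X in the step to u', both times
  in the block labelled \<open>a0\<close>. For u the value X must then belong to another block
  \<alpha>, whose minimum lies strictly between \<open>u b\<close> and X. Whether or not \<alpha>
  itself carries X in u, a contradiction results.\<close>

lemma differing_value_in_labels:
  assumes b: "u' b = X" "u b \<noteq> X"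
  shows "b \<in> I"
proof (rule ccontr)
  assume bI: "b \<notin> I"
  have surj: "\<exists>c. p c = y" if "p permutes {1..M}" for p y
    using permutes_surj[OF that] by (metis surjD)
  have inj: "p x = p y \<Longrightarrow> x = y" if "p permutes {1..M}" for p x y
    using permutes_inj[OF that] by (metis injD)
  define x where "x = u b"
  have xX: "x < X" using agree[of b] b unfolding x_def by linarith
  have ub: "u b \<noteq> w b" "u' b \<noteq> w b"
    using same_drops[OF bI] b by auto
  have yX: "X < w b" using block_step_drop[OF step_u'(1) bI] ub(2) b(1) by auto
  define a0 where "a0 = r b"
  have a0: "a0 \<in> I" "r a0 = a0" "r' a0 = a0"
    using block_step_moved[OF step_u(1) bI ub(1)] block_step_label[OF step_u(1)]
      block_step_label[OF step_u'(1)] by (auto simp: a0_def)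
  \<comment> \<open>The value \<open>w b\<close> exceeds X, and there both first steps have the same
    labels.\<close>
  have r'b: "r' b = a0"
  proof -
    obtain e where e: "u e = w b" using surj[OF perms(2)] by blast
    then have "u' e = w b" using agree[of e] yX by auto
    then have "r b = r e" "r' b = r' e"
      using block_step_same[OF step_u(1)] block_step_same[OF step_u'(1)] e by metis+
    then show ?thesis using first_labels_agree[of e] e yX by (simp add: a0_def)
  qed
  obtain cx where cx: "w cx = x" using surj[OF perms(1)] by blast
  have rcx: "r cx = a0" using block_step_same[OF step_u(1), of cx b] cx by (simp add: x_def a0_def)
  have wa0: "w a0 \<le> x" using block_step_min[OF step_u(1) a0(1) rcx] cx by simp
  obtain b' where b': "w b' = X" using surj[OF perms(1)] by blast
  have r'b': "r' b' = a0" using block_step_same[OF step_u'(1), of b' b] b' b(1) r'b by simp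
  have "b' \<noteq> a0" using b' wa0 xX by auto
  then have b'I: "b' \<notin> I" using block_step_label[OF step_u'(1)] r'b' by metis
  have "u' b' \<noteq> w b'" using block_step_fix[OF step_u'(1) b'I] r'b' \<open>b' \<noteq> a0\<close> by metis
  then have ub': "u b' \<noteq> w b'" using same_drops[OF b'I] by simp
  define \<alpha> where "\<alpha> = r b'"
  have \<alpha>: "\<alpha> \<in> I" "r \<alpha> = \<alpha>" "r' \<alpha> = \<alpha>"
    using block_step_moved[OF step_u(1) b'I ub'] block_step_label[OF step_u(1)]
      block_step_label[OF step_u'(1)] by (auto simp: \<alpha>_def)
  \<comment> \<open>X lies strictly between \<open>u b\<close> and \<open>w b\<close>, where the
    block of b has no value.\<close>
  have \<alpha>a0: "\<alpha> \<noteq> a0"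
    using block_step_gap[OF step_u(1) bI, of b'] b' xX yX by (auto simp: \<alpha>_def a0_def x_def)
  have w\<alpha>X: "w \<alpha> < X"
  proof -
    have "w \<alpha> \<le> X" using block_step_min[OF step_u(1) \<alpha>(1), of b'] b' by (simp add: \<alpha>_def)
    moreover have "\<alpha> \<noteq> b'" using \<alpha>(1) b'I by auto
    then have "w \<alpha> \<noteq> X" using b' inj[OF perms(1)] by metis
    ultimately show ?thesis by simp
  qed
  \<comment> \<open>Otherwise the values \<open>w \<alpha>\<close>, x, X, \<open>w b\<close> would
    alternate between the blocks \<alpha> and \<open>a0\<close> of r.\<close>
  have xw\<alpha>: "x < w \<alpha>"
  proof (rule ccontr)
    assume "\<not> x < w \<alpha>"
    moreover have "w \<alpha> \<noteq> x" using cx rcx \<alpha>(2) \<alpha>a0 inj[OF perms(1)] by metis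
    ultimately have "w \<alpha> < w cx" using cx by simp
    moreover have "w cx < w b'" "w b' < w b" using cx b' xX yX by auto
    ultimately have "r \<alpha> = r cx"
      using step_u(2) \<alpha>(2) rcx unfolding noncrossing_def by (metis \<alpha>_def a0_def)
    then show False using \<alpha>(2) rcx \<alpha>a0 by simp
  qed
  obtain P where P: "u P = X" using surj[OF perms(2)] by blast
  have rP: "r P = \<alpha>" using block_step_same[OF step_u(1), of b' P] b' P by (simp add: \<alpha>_def)
  have "X \<le> u \<alpha>" using block_step_max[OF step_u(1) \<alpha>(1), of b'] b' by (simp add: \<alpha>_def)
  show False
  proof (cases "u \<alpha> = X")
    \<comment> \<open>Here P drops to X from a value above X, where r and r' coincide. Hence
      \<open>w a0\<close>, \<open>w \<alpha>\<close>, X, \<open>w P\<close> alternate between two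
      blocks of r'.\<close>
    case False
    then have "P \<noteq> \<alpha>" using P by auto
    then have PI: "P \<notin> I" using block_step_label[OF step_u(1)] rP by metis
    have "P \<noteq> b'" using P b' ub' by auto
    then have "w P \<noteq> X" using b' inj[OF perms(1)] by metis
    then have wP: "X < w P" using block_step_drop[OF step_u(1) PI] P by auto
    have "r' P = \<alpha>"
    proof -
      obtain e where e: "u e = w P" using surj[OF perms(2)] by blast
      then have "u' e = w P" using agree[of e] wP by auto
      then have "r P = r e" "r' P = r' e"
        using block_step_same[OF step_u(1)] block_step_same[OF step_u'(1)] e by metis+
      then show ?thesis using first_labels_agree[of e] e wP rP by simp
    qed
    moreover have "w a0 < w \<alpha>" "w \<alpha> < w b'" "w b' < w P"
      using wa0 xw\<alpha> w\<alpha>X b' wP by auto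
    ultimately have "r' a0 = r' \<alpha>"
      using step_u'(2) a0(3) r'b' \<alpha>(3) unfolding noncrossing_def by metis
    then show False using a0(3) \<alpha>(3) \<alpha>a0 by simp
  next
    \<comment> \<open>Here the second-step label of X is \<alpha>, so b lies in the block of
      \<alpha> for the step from u'. Its minimum \<open>u' \<alpha>\<close> is at least
      \<open>w \<alpha>\<close>, hence above x, while \<open>v b\<close> is at most x.\<close>
    case True
    then have "s' b = \<alpha>"
      using second_labels_agree[of X \<alpha> b] b(1) block_step_label[OF step_v(1) \<alpha>(1)] by simp
    moreover obtain c where c: "u' c = v b" using surj[OF perms(3)] by blast
    ultimately have "s' c = \<alpha>" using block_step_same[OF step_v(2)] by metis
    then have "u' \<alpha> \<le> v b" using block_step_min[OF step_v(2) \<alpha>(1)] c by metis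
    also have "\<dots> \<le> x" using block_step_drop[OF step_v(1) bI] by (simp add: x_def)
    also have "x < w \<alpha>" by (rule xw\<alpha>)
    also have "\<dots> \<le> u' \<alpha>" using block_step_max[OF step_u'(1) \<alpha>(1) \<alpha>(3)] .
    finally show False by simp
  qed
qed

end

text \<open>At the largest value X placed differently, \<open>differing_value_in_labels\<close>,
  used in both directions, puts both positions carrying X into I. The second step assigns X one
  label, and a position in I is its own label, so the positions coincide.\<close>

theorem intermediate_perm_unique:
  assumes fin: "w \<in> finitary_perms" "u \<in> finitary_perms" "u' \<in> finitary_perms" "v \<in> finitary_perms"
    and step_u: "block_step I w u r" "noncrossing w r"
    and step_u': "block_step I w u' r'" "noncrossing w r'"
    and step_v: "block_step I u v s" "block_step I u' v s'"
    and same_drops: "\<And>b. b \<notin> I \<Longrightarrow> u b = w b \<longleftrightarrow> u' b = w b"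
  shows "u = u'"
proof (rule ccontr)
  assume ne: "u \<noteq> u'"
  obtain N1 N2 N3 N4 where N: "w permutes {1..N1}" "u permutes {1..N2}" "u' permutes {1..N3}" "v permutes {1..N4}"
    using fin by (auto simp: finitary_perms_def)
  define M where "M = N1 + N2 + N3 + N4"
  have perms: "w permutes {1..M}" "u permutes {1..M}" "u' permutes {1..M}" "v permutes {1..M}"
    using N by (auto simp: M_def intro: permutes_mono_atLeastAtMost simp del: One_nat_def)
  define D where "D = {x. \<exists>c. u c \<noteq> u' c \<and> (x = u c \<or> x = u' c)}"
  have "D \<subseteq> {..M}"
  proof
    fix x assume "x \<in> D"
    then obtain c where c: "u c \<noteq> u' c" "x = u c \<or> x = u' c" by (auto simp: D_def)
    then have "c \<in> {1..M}" using perms(2,3) by (metis permutes_def)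
    then show "x \<in> {..M}"
      using c(2) permutes_in_image[OF perms(2), of c] permutes_in_image[OF perms(3), of c] by auto
  qed
  then have "finite D" by (rule finite_subset) simp
  obtain c0 where "u c0 \<noteq> u' c0" using ne by blast
  then have "D \<noteq> {}" by (auto simp: D_def)
  define X where "X = Max D"
  have XD: "X \<in> D" unfolding X_def using \<open>finite D\<close> \<open>D \<noteq> {}\<close> by (rule Max_in)
  have agree: "u c = u' c" if "X < u c \<or> X < u' c" for c
  proof (rule ccontr)
    assume "u c \<noteq> u' c"
    then have "u c \<in> D" "u' c \<in> D" by (auto simp: D_def)
    then have "u c \<le> X" "u' c \<le> X" using \<open>finite D\<close> by (auto simp: X_def)
    then show False using that by simp
  qed
  obtain P where P: "u P = X" using permutes_surj[OF perms(2)] by (metis surjD)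
  obtain P' where P': "u' P' = X" using permutes_surj[OF perms(3)] by (metis surjD)
  have "P \<noteq> P'"
  proof
    assume "P = P'"
    obtain c where "u c \<noteq> u' c" "X = u c \<or> X = u' c" using XD by (auto simp: D_def)
    then show False
      using P P' \<open>P = P'\<close> permutes_inj[OF perms(2)] permutes_inj[OF perms(3)] by (metis injD)
  qed
  have uP': "u P' \<noteq> X" using P \<open>P \<noteq> P'\<close> permutes_inj[OF perms(2)] by (metis injD)
  have u'P: "u' P \<noteq> X" using P' \<open>P \<noteq> P'\<close> permutes_inj[OF perms(3)] by (metis injD)
  have agree': "u' c = u c" if "X < u' c \<or> X < u c" for c
    using agree[of c] that by auto
  have same_drops': "u' b = w b \<longleftrightarrow> u b = w b" if "b \<notin> I" for b
    using same_drops[OF that] by simp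
  have "P' \<in> I"
    by (rule differing_value_in_labels[OF perms step_u step_u' step_v same_drops agree P' uP'])
  moreover have "P \<in> I"
    by (rule differing_value_in_labels[OF perms(1,3,2,4) step_u' step_u step_v(2,1) same_drops' agree' P u'P])
  moreover have "s P = s' P'"
    by (rule second_labels_agree[OF perms step_u step_u' step_v same_drops agree order_refl P P'])
  ultimately show False
    using block_step_label[OF step_v(1)] block_step_label[OF step_v(2)] \<open>P \<noteq> P'\<close> by simp
qed

section \<open>Pieri's rule\<close>

lemma block_step_label_notin:
  assumes "block_step I l h r" "r c \<notin> I"
  shows "r c = c"
  using assms block_step_label block_step_fix block_step_moved by metis

lemma block_step_upper_bounds:
  assumes "block_step I l h r" "surj l" "a \<in> I" "r c = a"
  shows "l a \<le> h c" "h c \<le> h a"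
proof -
  obtain e where "l e = h c" using assms(2) by (metis surjD)
  moreover from this have "r e = a" using block_step_same[OF assms(1)] assms(4) by metis
  ultimately show "l a \<le> h c" "h c \<le> h a"
    using block_step_min[OF assms(1,3)] block_step_max[OF assms(1,3)] by metis+
qed

lemma block_step_nonmax:
  assumes "block_step I l h r" "surj l" "r c = r c'" "h c < h c'"
  shows "c \<notin> I" "r c \<in> I"
proof -
  show rI: "r c \<in> I"
    using block_step_label_notin[OF assms(1)] assms(3,4) by (metis less_irrefl)
  show "c \<notin> I"
  proof
    assume "c \<in> I"
    then have "r c' = c" using block_step_label[OF assms(1)] assms(3) by metis
    then have "h c' \<le> h c" using block_step_upper_bounds(2)[OF assms(1,2) \<open>c \<in> I\<close>] by blast
    then show False using assms(4) by simp
  qed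
qed

lemma block_step_conj:
  assumes "block_step I l h r"
  shows "block_step (adj i ` I) (l \<circ> adj i) (h \<circ> adj i) (adj i \<circ> r \<circ> adj i)"
proof -
  have mem: "x \<in> adj i ` I \<longleftrightarrow> adj i x \<in> I" for x
    by (metis image_iff transpose_involutory)
  have eq: "adj i x = adj i y \<longleftrightarrow> x = y" for x y
    by (metis transpose_involutory)
  have eq': "adj i x = y \<longleftrightarrow> x = adj i y" for x y
    by (metis transpose_involutory)
  show ?thesis
    unfolding block_step_def mem comp_def
    using block_stepD[OF assms]
    by (auto simp: eq mem)
      (metis eq')+
qed

lemma noncrossing_conj: "noncrossing h r \<Longrightarrow> noncrossing (h \<circ> adj i) (adj i \<circ> r \<circ> adj i)"
  unfolding noncrossing_def comp_def by (metis transpose_involutory)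

section \<open>States reached by cancelling last descents\<close>

definition max_descent :: "(nat \<Rightarrow> nat) \<Rightarrow> nat \<Rightarrow> bool" where
  "max_descent v i \<longleftrightarrow> v (Suc i) < v i \<and> (\<forall>x y. i < x \<longrightarrow> x < y \<longrightarrow> v x < v y)"

lemma increasing_from:
  fixes v :: "nat \<Rightarrow> nat"
  assumes "\<And>j. a \<le> j \<Longrightarrow> j < b \<Longrightarrow> v j < v (Suc j)" "a \<le> x" "x < y" "y \<le> b"
  shows "v x < v y"
  using assms(3,4)
proof (induction y)
  case (Suc y)
  then show ?case
    using assms(1)[of y] assms(2) by (cases "x = y") fastforce+
qed simp

lemma ex_max_descent:
  assumes "v \<in> finitary_perms" "v \<noteq> id"
  obtains i where "max_descent v i" "1 \<le> i"
proof -
  define D where "D = {i. v (Suc i) < v i}"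
  have "D \<subseteq> fst ` inversions v" by (force simp: D_def inversions_def)
  then have "finite D"
    using finite_inversions[OF assms(1)] by (auto intro: finite_subset)
  moreover have "D \<noteq> {}" using ex_descent[OF assms] by (auto simp: D_def)
  ultimately have D: "Max D \<in> D" "\<And>j. j \<in> D \<Longrightarrow> j \<le> Max D" by auto
  have asc: "v j < v (Suc j)" if "Max D < j" for j
  proof (rule ccontr)
    assume "\<not> v j < v (Suc j)"
    then have "v (Suc j) < v j"
      using finitary_perms_inj[OF assms(1), of j "Suc j"] by linarith
    then have "j \<in> D" by (simp add: D_def)
    then show False using D(2) that by fastforce
  qed
  have inc: "v x < v y" if xy: "Max D < x" "x < y" for x y
  proof (rule increasing_from[where v = v and a = "Suc (Max D)" and b = y])
    fix j assume "Suc (Max D) \<le> j"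
    then show "v j < v (Suc j)" by (intro asc Suc_le_lessD)
  next
    show "Suc (Max D) \<le> x" using xy(1) by (rule Suc_leI)
  qed (rule xy(2), rule order_refl)
  have desc: "v (Suc (Max D)) < v (Max D)" using D(1) by (simp add: D_def)
  then have "max_descent v (Max D)"
    unfolding max_descent_def using inc by blast
  then show ?thesis using that descent_pos[OF assms(1) desc] by blast
qed

text \<open>
  The pairs \<open>(v, I)\<close> reached when \<open>complete_hom {1..k} m\<close> is pushed through the reduced word of a
  Grassmannian permutation; on these, Leibniz' rule produces no negative terms.
\<close>

definition pos_state :: "(nat \<Rightarrow> nat) \<Rightarrow> nat set \<Rightarrow> bool" where
  "pos_state v I \<longleftrightarrow> v \<in> finitary_perms \<and> finite I \<and>
     (\<forall>x y. x \<notin> I \<longrightarrow> x < y \<longrightarrow> v x < v y) \<and>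
     (\<forall>x y z. x \<in> I \<longrightarrow> y \<in> I \<longrightarrow> x < y \<longrightarrow> y < z \<longrightarrow> v z < v y \<longrightarrow> v x < v y)"

lemma pos_stateD:
  assumes "pos_state v I"
  shows "v \<in> finitary_perms" "finite I" "x \<notin> I \<Longrightarrow> x < y \<Longrightarrow> v x < v y"
    "x \<in> I \<Longrightarrow> y \<in> I \<Longrightarrow> x < y \<Longrightarrow> y < z \<Longrightarrow> v z < v y \<Longrightarrow> v x < v y"
  using assms unfolding pos_state_def by blast+

lemma pos_state_descent_mem: "pos_state v I \<Longrightarrow> v (Suc i) < v i \<Longrightarrow> i \<in> I"
  using pos_stateD(3)[of v I i "Suc i"] by fastforce

text \<open>Shared by both branches of Leibniz' rule, whose new index sets lie in
  \<open>insert (Suc i) I\<close>. Once the last descent is cancelled, no position from i onwards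
  except i + 1 can have a smaller value to its right, which leaves y = i + 1 and y < i.\<close>

lemma pos_state_active_step:
  assumes "pos_state v I" "max_descent v i" "I' \<subseteq> insert (Suc i) I"
    "x \<in> I'" "y \<in> I'" "x < y" "y < z" "(v \<circ> adj i) z < (v \<circ> adj i) y"
  shows "(v \<circ> adj i) x < (v \<circ> adj i) y"
proof -
  have desc: "v (Suc i) < v i" and inc: "\<And>x y. i < x \<Longrightarrow> x < y \<Longrightarrow> v x < v y"
    using assms(2) by (auto simp: max_descent_def)
  have iI: "i \<in> I" using pos_state_descent_mem[OF assms(1) desc] .
  consider "y = Suc i" | "y = i" | "Suc i < y" | "y < i" by linarith
  then show ?thesis
  proof cases
    case 1
    show ?thesis
    proof (cases "x = i")
      case True
      then show ?thesis using 1 desc by simp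
    next
      case False
      then have "x < i" "x \<in> I" using 1 assms(3,4,6) by auto
      then show ?thesis using pos_stateD(4)[OF assms(1) _ iI, of x "Suc i"] desc 1 by simp
    qed
  next
    case 2
    then show ?thesis
      using assms(7,8) desc inc[of "Suc i" z] by (cases "z = Suc i") auto
  next
    case 3
    then show ?thesis using assms(7,8) inc[of y z] by simp
  next
    case 4
    then have mem: "x \<in> I" "y \<in> I" using assms(3-6) by auto
    have "y < adj i z" using 4 assms(7) by (auto simp: transpose_def)
    then show ?thesis
      using pos_stateD(4)[OF assms(1) mem assms(6)] assms(6,8) 4 by simp
  qed
qed

text \<open>The branch in which the letter i is passed on to the other factor f.\<close>

lemma pos_state_keep:
  assumes "pos_state v I" "max_descent v i" "1 \<le> i"
  shows "pos_state (v \<circ> adj i) (adj i ` I)"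
proof -
  have desc: "v (Suc i) < v i" using assms(2) by (auto simp: max_descent_def)
  have iI: "i \<in> I" using pos_state_descent_mem[OF assms(1) desc] .
  have mem: "x \<in> adj i ` I \<longleftrightarrow> adj i x \<in> I" for x
    by (metis image_iff transpose_involutory)
  have "(v \<circ> adj i) x < (v \<circ> adj i) y" if "x \<notin> adj i ` I" "x < y" for x y
  proof (cases "x = i \<and> y = Suc i")
    case True
    then show ?thesis using desc by simp
  next
    case False
    then have "adj i x < adj i y" using that(2) by (auto simp: transpose_def)
    then show ?thesis using pos_stateD(3)[OF assms(1)] that(1) mem by simp
  qed
  moreover have "adj i ` I \<subseteq> insert (Suc i) I" using iI by (auto simp: transpose_def)
  ultimately show ?thesis
    unfolding pos_state_def
    using finitary_perms_adj[OF pos_stateD(1)[OF assms(1)] assms(3)] pos_stateD(2)[OF assms(1)]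
      pos_state_active_step[OF assms(1,2)] by blast
qed

text \<open>The branch in which the letter i is spent on the complete homogeneous factor, whose
  index set gains i + 1 by \<open>dd_complete_hom\<close>.\<close>

lemma pos_state_delete:
  assumes "pos_state v I" "max_descent v i" "1 \<le> i"
  shows "pos_state (v \<circ> adj i) (insert (Suc i) I)"
proof -
  have desc: "v (Suc i) < v i" using assms(2) by (auto simp: max_descent_def)
  have iI: "i \<in> I" using pos_state_descent_mem[OF assms(1) desc] .
  have "(v \<circ> adj i) x < (v \<circ> adj i) y" if "x \<notin> insert (Suc i) I" "x < y" for x y
  proof -
    have "x \<noteq> i" "x \<noteq> Suc i" using that(1) iI by auto
    then have "x < adj i y" "adj i x = x" using that(2) by (auto simp: transpose_def)
    then show ?thesis using pos_stateD(3)[OF assms(1)] that(1) by simp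
  qed
  then show ?thesis
    unfolding pos_state_def
    using finitary_perms_adj[OF pos_stateD(1)[OF assms(1)] assms(3)] pos_stateD(2)[OF assms(1)]
      pos_state_active_step[OF assms(1,2) order_refl] by (metis finite_insert)
qed

text \<open>The cardinality of this set will be the degree of the complete homogeneous
  factor.\<close>

definition moved :: "nat set \<Rightarrow> (nat \<Rightarrow> nat) \<Rightarrow> (nat \<Rightarrow> nat) \<Rightarrow> nat set" where
  "moved I u v = {b. b \<notin> I \<and> v b \<noteq> u b}"

lemma moved_conj: "moved (adj i ` I) (u \<circ> adj i) (v \<circ> adj i) = adj i ` moved I u v"
proof -
  have mem: "x \<in> adj i ` A \<longleftrightarrow> adj i x \<in> A" for x A
    by (metis image_iff transpose_involutory)
  show ?thesis by (rule set_eqI, subst mem) (simp add: moved_def mem)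
qed

lemma card_moved_conj: "card (moved (adj i ` I) (u \<circ> adj i) (v \<circ> adj i)) = card (moved I u v)"
  unfolding moved_conj by (intro card_image inj_on_subset[OF inj_transpose]) simp

lemma finite_moved:
  assumes "u \<in> finitary_perms" "v \<in> finitary_perms"
  shows "finite (moved I u v)"
proof -
  obtain N M where "u permutes {1..N}" "v permutes {1..M}"
    using assms by (auto simp: finitary_perms_def)
  then have "moved I u v \<subseteq> {1..N} \<union> {1..M}"
    by (auto simp: moved_def permutes_def)
  then show ?thesis by (rule finite_subset) simp
qed

text \<open>
  Away from \<open>I = {1..k}\<close> crossing blocks do occur, but only if the position of the smallest value
  involved lies to the left of the label of the other block.
\<close>

definition state_step :: "nat set \<Rightarrow> nat \<Rightarrow> (nat \<Rightarrow> nat) \<Rightarrow> (nat \<Rightarrow> nat) \<Rightarrow> bool" where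
  "state_step I m u v \<longleftrightarrow> (\<exists>r. block_step I u v r \<and>
     (\<forall>b. b \<notin> I \<longrightarrow> r b \<noteq> b \<longrightarrow> r b < b) \<and>
     (\<forall>c d c' d'. r c = r c' \<longrightarrow> r d = r d' \<longrightarrow> v c < v d \<longrightarrow> v d < v c' \<longrightarrow> v c' < v d' \<longrightarrow>
        r c \<noteq> r d \<longrightarrow> c < r d) \<and>
     card (moved I u v) = m)"

lemma adj_less: "x < y \<Longrightarrow> \<not> (x = i \<and> y = Suc i) \<Longrightarrow> adj i x < adj i y"
  by (auto simp: transpose_def)

text \<open>Conjugation by \<open>adj i\<close> transports the block structure. It can reverse an
  inequality between positions only for the pair i, i + 1, so the work lies in excluding this pair
  from the two positional conditions.\<close>

lemma state_step_keep:
  assumes state: "pos_state v I" and desc: "max_descent v i" and i1: "1 \<le> i"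
    and fin: "u \<in> finitary_perms"
    and step: "state_step (adj i ` I) m u (v \<circ> adj i)"
    and asc: "u i < u (Suc i)"
  shows "state_step I m (u \<circ> adj i) v"
proof -
  define I' v' where "I' = adj i ` I" and "v' = v \<circ> adj i"
  have mem: "x \<in> I' \<longleftrightarrow> adj i x \<in> I" for x
    unfolding I'_def by (metis image_iff transpose_involutory)
  have adjI: "adj i ` I' = I" and vv: "v' \<circ> adj i = v"
    by (simp_all add: I'_def v'_def image_comp comp_assoc)
  have iI: "i \<in> I"
    using pos_state_descent_mem[OF state] desc by (auto simp: max_descent_def)
  have state': "pos_state v' I'"
    unfolding v'_def I'_def by (rule pos_state_keep[OF state desc i1])
  have surj: "surj u" using finitary_perms_bij[OF fin] by (rule bij_is_surj)
  have injv: "v' x = v' y \<Longrightarrow> x = y" for x y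
    using finitary_perms_inj[OF pos_stateD(1)[OF state']] by simp
  have surjv: "\<exists>x. v' x = y" for y
    using finitary_perms_bij[OF pos_stateD(1)[OF state']] by (metis bij_pointE)
  obtain r where bs: "block_step I' u v' r"
    and left: "\<And>b. b \<notin> I' \<Longrightarrow> r b \<noteq> b \<Longrightarrow> r b < b"
    and nc: "\<And>c d c' d'. r c = r c' \<Longrightarrow> r d = r d' \<Longrightarrow> v' c < v' d \<Longrightarrow> v' d < v' c' \<Longrightarrow>
      v' c' < v' d' \<Longrightarrow> r c \<noteq> r d \<Longrightarrow> c < r d"
    and card: "card (moved I' u v') = m"
    using step unfolding state_step_def I'_def[symmetric] v'_def[symmetric] by blast
  let ?r = "adj i \<circ> r \<circ> adj i"
  have "block_step I (u \<circ> adj i) v ?r"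
    using block_step_conj[OF bs, of i] by (simp only: adjI vv)
  moreover have "?r b < b" if b: "b \<notin> I" "?r b \<noteq> b" for b
  proof -
    define \<beta> where "\<beta> = adj i b"
    have \<beta>: "\<beta> \<notin> I'" "r \<beta> \<noteq> \<beta>" "b = adj i \<beta>"
      using b by (auto simp: \<beta>_def mem)
    have "r \<beta> < \<beta>" by (rule left[OF \<beta>(1,2)])
    moreover have "\<not> (r \<beta> = i \<and> \<beta> = Suc i)"
      using \<beta>(1) iI by (auto simp: mem)
    ultimately have "adj i (r \<beta>) < adj i \<beta>" by (rule adj_less)
    then show ?thesis by (simp add: \<beta>_def)
  qed
  moreover have "c < ?r d" if h: "?r c = ?r c'" "?r d = ?r d'" "v c < v d" "v d < v c'" "v c' < v d'" "?r c \<noteq> ?r d"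
    for c d c' d'
  proof -
    define \<gamma> \<delta> \<gamma>' \<delta>' where "\<gamma> = adj i c" and "\<delta> = adj i d" and "\<gamma>' = adj i c'" and "\<delta>' = adj i d'"
    have adj_eq: "adj i x = adj i y \<Longrightarrow> x = y" for x y
      by (metis transpose_involutory)
    have h': "r \<gamma> = r \<gamma>'" "r \<delta> = r \<delta>'" "v' \<gamma> < v' \<delta>" "v' \<delta> < v' \<gamma>'" "v' \<gamma>' < v' \<delta>'" "r \<gamma> \<noteq> r \<delta>"
      using h by (auto simp: \<gamma>_def \<delta>_def \<gamma>'_def \<delta>'_def v'_def dest: adj_eq)
    have lt: "\<gamma> < r \<delta>" by (rule nc[OF h'])
    have "\<not> (\<gamma> = i \<and> r \<delta> = Suc i)"
    proof
      assume *: "\<gamma> = i \<and> r \<delta> = Suc i"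
      have iI': "i \<notin> I'" and riI: "r i \<in> I'"
        using block_step_nonmax[OF bs surj h'(1)] h'(3,4) * by auto
      have SI': "Suc i \<in> I'"
        using block_step_nonmax(2)[OF bs surj h'(2)] h'(4,5) * by auto
      have "v' i \<noteq> u i"
        using block_step_fix[OF bs iI'] riI iI' by metis
      then have drop: "v' i < u i" using block_step_drop[OF bs iI'] by simp
      obtain e where e: "v' e = u i" using surjv by blast
      have re: "r e = r i" using block_step_same[OF bs, of i e] e by simp
      \<comment> \<open>The value \<open>u i\<close> sits in v' at a position e of the block of i.
        Were it below \<open>v' \<delta>\<close>, the crossing condition would put e left of i,
        where \<open>pos_state\<close> makes its value smaller than \<open>v' i\<close>. Hence
        \<open>u (Suc i) \<le> v' \<delta> < u i\<close>, against the ascent.\<close>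
      have "\<not> u i < v' \<delta>"
      proof
        assume "u i < v' \<delta>"
        then have "v' e < v' \<delta>" by (simp add: e)
        then have "e < Suc i"
          using nc[of e \<gamma>' \<delta> \<delta>'] h' re * by auto
        moreover have "e \<noteq> i" using e drop by auto
        ultimately have "e < i" by simp
        moreover have "e \<notin> I'"
          using block_step_nonmax(1)[OF bs surj, of e \<gamma>'] re h' * e \<open>u i < v' \<delta>\<close> by auto
        ultimately have "v' e < v' i" using pos_stateD(3)[OF state'] by blast
        then show False using e drop by simp
      qed
      moreover have "u i \<noteq> v' \<delta>"
        using e re h'(6) * injv by metis
      ultimately have "v' \<delta> < u i" by simp
      moreover have "u (Suc i) \<le> v' \<delta>"
        using block_step_upper_bounds(1)[OF bs surj SI'] * by blast
      ultimately show False using asc by simp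
    qed
    from adj_less[OF lt this] show ?thesis
      by (simp add: \<gamma>_def \<delta>_def)
  qed
  moreover have "card (moved I (u \<circ> adj i) v) = m"
    using card_moved_conj[of i I' u v'] card by (simp only: adjI vv)
  ultimately show ?thesis
    unfolding state_step_def by blast
qed

text \<open>The blocks of i and i + 1 merge into one labelled i. Without its status as a label, i +
  1 becomes a dropping position, which is the additional moved one. The ascent of u at i will
  separate these u from those of the kept branch.\<close>

lemma state_step_delete:
  assumes state: "pos_state v I" and desc: "max_descent v i" and i1: "1 \<le> i"
    and SI: "Suc i \<notin> I" and fin: "u \<in> finitary_perms"
    and step: "state_step (insert (Suc i) I) m u (v \<circ> adj i)"
  shows "state_step I (Suc m) u v" "u i < u (Suc i)"
proof -
  define I' v' where "I' = insert (Suc i) I" and "v' = v \<circ> adj i"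
  have vi: "v i = v' (Suc i)" and vS: "v (Suc i) = v' i"
    and vo: "\<And>x. x \<noteq> i \<Longrightarrow> x \<noteq> Suc i \<Longrightarrow> v x = v' x"
    by (simp_all add: v'_def)
  have dsc: "v (Suc i) < v i" and inc: "\<And>x y. i < x \<Longrightarrow> x < y \<Longrightarrow> v x < v y"
    using desc by (auto simp: max_descent_def)
  have iI: "i \<in> I" using pos_state_descent_mem[OF state dsc] .
  then have iI': "i \<in> I'" and SI': "Suc i \<in> I'" by (auto simp: I'_def)
  have low: "v' i < v' x" if "i < x" for x
    using that dsc inc[of "Suc i" x] vi vS vo[of x] by (cases "x = Suc i") auto
  have inc': "v' x < v' y" if "Suc i < x" "x < y" for x y
    using that inc[of x y] vo[of x] vo[of y] by auto
  have state': "pos_state v' I'"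
    unfolding v'_def I'_def by (rule pos_state_delete[OF state desc i1])
  have surj: "surj u" using finitary_perms_bij[OF fin] by (rule bij_is_surj)
  have surjv: "\<exists>x. v' x = y" for y
    using finitary_perms_bij[OF pos_stateD(1)[OF state']] by (metis bij_pointE)
  obtain r where bs: "block_step I' u v' r"
    and left: "\<And>b. b \<notin> I' \<Longrightarrow> r b \<noteq> b \<Longrightarrow> r b < b"
    and nc: "\<And>c d c' d'. r c = r c' \<Longrightarrow> r d = r d' \<Longrightarrow> v' c < v' d \<Longrightarrow> v' d < v' c' \<Longrightarrow>
      v' c' < v' d' \<Longrightarrow> r c \<noteq> r d \<Longrightarrow> c < r d"
    and card: "card (moved I' u v') = m"
    using step unfolding state_step_def I'_def[symmetric] v'_def[symmetric] by blast
  have rI: "r a = a" if "a \<in> I'" for a using block_step_label[OF bs that] .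
  \<comment> \<open>Any further member of the block of i would lie right of i, but
    \<open>v' i\<close> is smaller than all values to its right and yet the maximum of its
    block.\<close>
  have triv: "c = i" if "r c = i" for c
  proof (rule ccontr)
    assume "c \<noteq> i"
    then have "c \<notin> I'" using rI that by metis
    then have "i < c" using left[of c] that \<open>c \<noteq> i\<close> by simp
    then show False
      using low block_step_upper_bounds(2)[OF bs surj iI' that] by fastforce
  qed
  have blockS: "c = Suc i \<or> (Suc i < c \<and> c \<notin> I')" if "r c = Suc i" for c
    using left[of c] rI[of c] that by (cases "c \<in> I'") auto
  have ui: "u i = v' i"
  proof -
    obtain e where e: "v' e = u i" using surjv by blast
    then have "r e = i" using block_step_same[OF bs, of i e] rI[OF iI'] by simp
    then show ?thesis using triv e by metis
  qed
  have uS: "v' i < u (Suc i)"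
  proof -
    obtain e where e: "v' e = u (Suc i)" using surjv by blast
    then have "r e = Suc i" using block_step_same[OF bs, of "Suc i" e] rI[OF SI'] by simp
    then have "i < e" using blockS by fastforce
    then show ?thesis using low e by metis
  qed
  then show "u i < u (Suc i)" by (simp add: ui)
  \<comment> \<open>The trivial block of i contributes \<open>u i\<close> as the new minimum, onto
    which i + 1 drops; the maximum \<open>v' (Suc i)\<close> becomes \<open>v i\<close>.\<close>
  define \<rho> where "\<rho> c = (if r c = Suc i then i else r c)" for c
  have \<rho>i: "\<rho> c = i \<longleftrightarrow> c = i \<or> r c = Suc i" for c
    using triv rI[OF iI'] by (auto simp: \<rho>_def)
  have \<rho>ne: "\<rho> c = r c" if "\<rho> c \<noteq> i" for c
    using that by (auto simp: \<rho>_def)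
  have \<rho>S: "\<rho> (Suc i) = i" and \<rho>ii: "\<rho> i = i"
    using rI[OF SI'] by (simp_all add: \<rho>i)
  have "block_step I u v \<rho>"
    unfolding block_step_def
  proof (intro conjI ballI allI impI)
    fix a assume "a \<in> I"
    then show "\<rho> a = a" using SI rI[of a] by (auto simp: \<rho>_def I'_def)
  next
    fix c d assume cd: "u c = v d"
    consider "d = i" | "d = Suc i" | "d \<noteq> i" "d \<noteq> Suc i" by blast
    then show "\<rho> c = \<rho> d"
    proof cases
      case 1
      then have "r c = Suc i" using block_step_same[OF bs, of c "Suc i"] cd vi rI[OF SI'] by simp
      then show ?thesis using 1 \<rho>ii by (simp add: \<rho>_def)
    next
      case 2
      then have "r c = i" using block_step_same[OF bs, of c i] cd vS rI[OF iI'] by simp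
      then show ?thesis using 2 \<rho>S by (simp add: \<rho>_def)
    next
      case 3
      then have "r c = r d" using block_step_same[OF bs, of c d] cd vo by simp
      then show ?thesis by (simp add: \<rho>_def)
    qed
  next
    fix b assume b: "b \<notin> I"
    show "v b \<le> u b"
    proof (cases "b = Suc i")
      case True
      then show ?thesis using uS vS by simp
    next
      case False
      then have "b \<notin> I'" "b \<noteq> i" using b iI by (auto simp: I'_def)
      then show ?thesis using block_step_drop[OF bs] vo False by simp
    qed
  next
    fix b c assume b: "b \<notin> I" "\<rho> c = \<rho> b"
    show "\<not> (v b < u c \<and> u c < u b)"
    proof (cases "b = Suc i")
      case True
      then have "c = i \<or> r c = Suc i" using b(2) \<rho>S \<rho>i by simp
      then show ?thesis
      proof
        assume "c = i"
        then show ?thesis using True vS ui by simp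
      next
        assume "r c = Suc i"
        then show ?thesis using block_step_min[OF bs SI', of c] True by simp
      qed
    next
      case False
      then have bb: "b \<notin> I'" "b \<noteq> i" using b iI by (auto simp: I'_def)
      then have vb: "v b = v' b" using vo False by simp
      show ?thesis
      proof (cases "\<rho> b = i")
        case True
        then have rb: "r b = Suc i" using \<rho>i bb by simp
        from True b(2) have "c = i \<or> r c = Suc i" using \<rho>i by metis
        then show ?thesis
        proof
          assume "c = i"
          have "i < b" using blockS[OF rb] by auto
          then show ?thesis using \<open>c = i\<close> low[of b] ui vb by simp
        next
          assume "r c = Suc i"
          then show ?thesis using block_step_gap[OF bs bb(1), of c] rb vb by auto
        qed
      next
        case F: False
        then have "r c = r b" using b(2) \<rho>ne by metis
        then show ?thesis using block_step_gap[OF bs bb(1), of c] vb by auto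
      qed
    qed
  next
    fix a c assume a: "a \<in> I" "\<rho> c = a"
    show "u a \<le> u c"
    proof (cases "a = i")
      case True
      then have "c = i \<or> r c = Suc i" using a \<rho>i by simp
      then show ?thesis
      proof
        assume "r c = Suc i"
        then have "u (Suc i) \<le> u c" by (rule block_step_min[OF bs SI'])
        then show ?thesis using True uS ui by simp
      qed (use True in simp)
    next
      case False
      then have "r c = a" using a \<rho>ne by metis
      then show ?thesis using block_step_min[OF bs] a by (auto simp: I'_def)
    qed
  next
    fix a c assume a: "a \<in> I" "\<rho> c = a"
    show "u c \<le> v a"
    proof (cases "a = i")
      case True
      then have "c = i \<or> r c = Suc i" using a \<rho>i by simp
      then show ?thesis
      proof
        assume "r c = Suc i"
        then have "u c \<le> v' (Suc i)" by (rule block_step_max[OF bs SI'])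
        then show ?thesis using True vi by simp
      next
        assume "c = i"
        then show ?thesis using True ui vi low[of "Suc i"] by simp
      qed
    next
      case False
      then have "r c = a" "a \<noteq> Suc i" using a \<rho>ne SI by metis+
      then show ?thesis using block_step_max[OF bs, of a c] a False vo by (auto simp: I'_def)
    qed
  next
    fix b assume b: "b \<notin> I"
    show "if v b = u b then \<rho> b = b else \<rho> b \<in> I"
    proof (cases "b = Suc i")
      case True
      then show ?thesis using uS vS \<rho>S iI by simp
    next
      case False
      then have bb: "b \<notin> I'" "b \<noteq> i" using b iI by (auto simp: I'_def)
      then have vb: "v b = v' b" using vo False by simp
      show ?thesis
      proof (cases "v' b = u b")
        case True
        then show ?thesis using block_step_fix[OF bs bb(1)] False vb by (simp add: \<rho>_def)
      next
        case F: False
        then show ?thesis using block_step_moved[OF bs bb(1)] iI vb by (auto simp: \<rho>_def I'_def)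
      qed
    qed
  qed
  moreover have "\<rho> b < b" if b: "b \<notin> I" "\<rho> b \<noteq> b" for b
  proof (cases "b = Suc i")
    case True
    then show ?thesis using \<rho>S by simp
  next
    case False
    then have bb: "b \<notin> I'" using b by (simp add: I'_def)
    moreover have "r b \<noteq> b" using b(2) False by (auto simp: \<rho>_def)
    ultimately have "r b < b" by (rule left)
    then show ?thesis by (auto simp: \<rho>_def)
  qed
  moreover have "c < \<rho> d"
    if h: "\<rho> c = \<rho> c'" "\<rho> d = \<rho> d'" "v c < v d" "v d < v c'" "v c' < v d'" "\<rho> c \<noteq> \<rho> d"
    for c d c' d'
  proof -
    have v_low: "v (Suc i) \<le> v x" and v_high: "v x \<le> v i" if "\<rho> x = i" for x
    proof -
      have "x = i \<or> x = Suc i \<or> (r x = Suc i \<and> x \<noteq> i \<and> x \<noteq> Suc i \<and> Suc i < x)"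
        using \<rho>i that blockS[of x] by auto
      moreover have "v (Suc i) \<le> v x \<and> v x \<le> v i" if x: "r x = Suc i" "x \<noteq> i" "x \<noteq> Suc i" "Suc i < x"
        using low[of x] block_step_upper_bounds(2)[OF bs surj SI' x(1)] x vi vS vo[of x] by auto
      ultimately show "v (Suc i) \<le> v x" "v x \<le> v i" using dsc by auto
    qed
    \<comment> \<open>Apart from i + 1, which carries the minimum, the members of the merged block
      correspond under \<open>adj i\<close> to members of the old block of i + 1 with the same
      value.\<close>
    have rS: "r (adj i x) = Suc i \<and> v' (adj i x) = v x" if "\<rho> x = i" "x \<noteq> Suc i" for x
      using that \<rho>i[of x] rI[OF SI'] vi vo[of x] by (cases "x = i") auto
    have ro: "r x = \<rho> x \<and> v' x = v x \<and> x \<noteq> i \<and> x \<noteq> Suc i" if "\<rho> x \<noteq> i" for x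
      using that \<rho>ne \<rho>S \<rho>ii vo by metis
    consider (W) "\<rho> c = i" | (Z) "\<rho> d = i" | (N) "\<rho> c \<noteq> i" "\<rho> d \<noteq> i" by blast
    then show ?thesis
    proof cases
      case W
      then have zi: "\<rho> d \<noteq> i" "\<rho> d' \<noteq> i" "\<rho> c' = i" using h by auto
      have rd: "r d = \<rho> d" "r d' = \<rho> d" "v' d = v d" "v' d' = v d'" "d \<noteq> i"
        using ro zi h(2) by metis+
      have c'S: "c' \<noteq> Suc i"
        using h(3,4) v_low[OF W] by auto
      have c'r: "r (adj i c') = Suc i" "v' (adj i c') = v c'"
        using rS[OF zi(3) c'S] by auto
      have dn: "d \<notin> I'" and rdI: "r d \<in> I'"
        using block_step_nonmax[OF bs surj, of d d'] rd h by auto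
      define z where "z = \<rho> d"
      have zI: "z \<in> I'" "r z = z" using rdI rd rI by (auto simp: z_def)
      have "z \<noteq> Suc i" using \<rho>i zi(1) rd unfolding z_def by metis
      moreover have "z \<noteq> i" using zi by (simp add: z_def)
      \<comment> \<open>Beyond i + 1 the values of \<open>v'\<close> increase, so such a label,
        lying left of d, could not carry the maximum of its block.\<close>
      moreover have "\<not> Suc i < z"
      proof
        assume "Suc i < z"
        have "d \<noteq> z" using dn zI by auto
        then have "z < d" using left[OF dn] rd by (simp add: z_def)
        then have "v' z < v' d" using inc' \<open>Suc i < z\<close> by blast
        moreover have "v' d \<le> v' z"
          using block_step_upper_bounds(2)[OF bs surj zI(1), of d] rd by (simp add: z_def)
        ultimately show False by simp
      qed
      ultimately have zlt: "z < i" by linarith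
      \<comment> \<open>The second clause of \<open>pos_state\<close> now puts the block of z below
        the top of the merged block. If c = i + 1, this produces the crossing d, c', d', i + 1 among
        the old blocks.\<close>
      have "z \<in> I" using zI(1) \<open>z \<noteq> Suc i\<close> by (simp add: I'_def)
      then have "v z < v i"
        using pos_stateD(4)[OF state _ iI zlt, of "Suc i"] dsc by simp
      moreover have "v' d' \<le> v' z"
        using block_step_upper_bounds(2)[OF bs surj zI(1), of d'] rd by (simp add: z_def)
      ultimately have d'lt: "v' d' < v' (Suc i)"
        using vi vo[of z] zlt by auto
      show ?thesis
      proof (cases "c = Suc i")
        case True
        have "d < r (adj i c')"
          using nc[of d d' "adj i c'" "Suc i"] rd c'r h d'lt zi rI[OF SI'] \<open>z \<noteq> Suc i\<close>
          by (auto simp: z_def)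
        then have "d < i" using c'r(1) rd(5) by simp
        then have "v' d < v' i" using pos_stateD(3)[OF state' dn] by blast
        then show ?thesis using True h(3) vS rd by simp
      next
        case False
        have cr: "r (adj i c) = Suc i" "v' (adj i c) = v c" using rS[OF W False] by auto
        have "c \<noteq> i" using v_high[OF zi(3)] h(3,4) by auto
        then have "adj i c = c" using False by simp
        then have "c < z"
          using nc[of c "adj i c'" d d'] cr c'r rd h \<open>z \<noteq> Suc i\<close> by (auto simp: z_def)
        then show ?thesis by (simp add: z_def)
      qed
    next
      case Z
      then have ci: "\<rho> c \<noteq> i" "\<rho> c' \<noteq> i" "\<rho> d' = i" using h by auto
      have rc: "r c = \<rho> c" "r c' = \<rho> c" "v' c = v c" "v' c' = v c'" "c \<noteq> i" "c \<noteq> Suc i"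
        using ro ci h(1) by metis+
      have d'S: "d' \<noteq> Suc i" using h(4,5) v_low[OF Z] by auto
      have d'r: "r (adj i d') = Suc i" "v' (adj i d') = v d'" using rS[OF ci(3) d'S] by auto
      have "c < i"
      proof (cases "d = Suc i")
        case True
        then have "v' c < v' i" using h(3) vS rc by simp
        then show ?thesis using low[of c] rc by (cases "i < c") auto
      next
        case False
        have dr: "r (adj i d) = Suc i" "v' (adj i d) = v d" using rS[OF Z False] by auto
        have "r c \<noteq> Suc i" using \<rho>i ci(1) rc by metis
        then have "c < r (adj i d)"
          using nc[of c c' "adj i d" "adj i d'"] rc dr d'r h by auto
        then show ?thesis using dr(1) rc by simp
      qed
      then show ?thesis using Z by simp
    next
      case N
      then have "\<rho> c' \<noteq> i" "\<rho> d' \<noteq> i" using h by auto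
      then show ?thesis
        using nc[of c c' d d'] ro N h by metis
    qed
  qed
  moreover have "card (moved I u v) = Suc m"
  proof -
    have "moved I u v = insert (Suc i) (moved I' u v')"
    proof (rule set_eqI)
      fix x
      consider "x = i" | "x = Suc i" | "x \<noteq> i" "x \<noteq> Suc i" by blast
      then show "x \<in> moved I u v \<longleftrightarrow> x \<in> insert (Suc i) (moved I' u v')"
        by cases (use iI SI uS vS vo in \<open>auto simp: moved_def I'_def\<close>)
    qed
    moreover have "Suc i \<notin> moved I' u v'" using SI' by (simp add: moved_def)
    moreover have "finite (moved I' u v')" using finite_moved[OF fin pos_stateD(1)[OF state']] .
    ultimately show ?thesis using card by simp
  qed
  ultimately show "state_step I (Suc m) u v"
    unfolding state_step_def by blast
qed

section \<open>Pieri expansions by induction on length\<close>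

lemma sum_dd_perm_dd:
  assumes "finite P" "P \<subseteq> finitary_perms" "1 \<le> i"
  shows "(\<Sum>u\<in>P. const_coeff (dd_perm u (dd i f))) =
    (\<Sum>u\<in>(\<lambda>u. u \<circ> adj i) ` {u \<in> P. u i < u (Suc i)}. const_coeff (dd_perm u f))"
proof -
  have inj: "inj_on (\<lambda>u. u \<circ> adj i) {u \<in> P. u i < u (Suc i)}"
    by (rule inj_onI) (metis comp_assoc comp_id transpose_comp_involutory)
  have "(\<Sum>u\<in>P. const_coeff (dd_perm u (dd i f))) =
      (\<Sum>u\<in>P. if u i < u (Suc i) then const_coeff (dd_perm (u \<circ> adj i) f) else 0)"
    using assms by (intro sum.cong const_coeff_dd_perm_dd) auto
  also have "\<dots> = (\<Sum>u\<in>{u \<in> P. u i < u (Suc i)}. const_coeff (dd_perm (u \<circ> adj i) f))"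
    by (rule sum.inter_filter[symmetric]) (rule assms(1))
  also have "\<dots> = (\<Sum>u\<in>(\<lambda>u. u \<circ> adj i) ` {u \<in> P. u i < u (Suc i)}. const_coeff (dd_perm u f))"
    by (simp only: sum.reindex[OF inj] comp_def[of "\<lambda>u. const_coeff (dd_perm u f)"])
  finally show ?thesis .
qed

lemma adj_image_eq:
  assumes "i \<in> I \<longleftrightarrow> Suc i \<in> I"
  shows "adj i ` I = I"
proof -
  have "adj i ` I \<subseteq> I" using assms by (auto simp: transpose_def)
  moreover from this have "adj i ` adj i ` I \<subseteq> adj i ` I" by (rule image_mono)
  ultimately show ?thesis by (simp add: image_comp)
qed

lemma dd_complete_hom_eq_0:
  assumes "i \<in> I \<longleftrightarrow> Suc i \<in> I"
  shows "dd i (complete_hom I m) = 0"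
  by (rule dd_eq_0_if_swap_vars_eq) (simp only: swap_vars_complete_hom adj_image_eq[OF assms])

text \<open>Leibniz' rule at the last descent i. Permutations from the kept branch have a descent at
  i, those from the other branch an ascent; the two families are disjoint, so no multiplicity
  arises.\<close>

lemma pieri_state:
  assumes "pos_state v I"
  shows "\<exists>P. finite P \<and> P \<subseteq> finitary_perms \<and> (\<forall>u\<in>P. state_step I m u v) \<and>
    (\<forall>f. const_coeff (dd_perm v (complete_hom I m * f)) = (\<Sum>u\<in>P. const_coeff (dd_perm u f)))"
  using assms
proof (induction "perm_length v" arbitrary: v I m rule: less_induct)
  case less
  note fin = pos_stateD(1)[OF less.prems]
  show ?case
  proof (cases "v = id")
    case True
    have "state_step I 0 id id"
      unfolding state_step_def by (rule exI[of _ id]) (auto simp: block_step_def moved_def)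
    then show ?thesis
      unfolding True dd_perm_id const_coeff_complete_hom_mult
      by (intro exI[of _ "if m = 0 then {id} else {}"]) auto
  next
    case False
    obtain i where desc: "max_descent v i" and i1: "1 \<le> i"
      using ex_max_descent[OF fin False] .
    have d: "v (Suc i) < v i" using desc by (simp add: max_descent_def)
    have iI: "i \<in> I" using pos_state_descent_mem[OF less.prems d] .
    define v' where "v' = v \<circ> adj i"
    have len: "perm_length v' < perm_length v"
      using perm_length_adj[OF fin d] by (simp add: v'_def)
    have ddv: "const_coeff (dd_perm v (complete_hom I m * f)) =
        const_coeff (dd_perm v' (dd i (complete_hom I m) * f)) +
        const_coeff (dd_perm v' (complete_hom (adj i ` I) m * dd i f))" for f
      unfolding dd_perm_descent[OF fin d] v'_def[symmetric] dd_complete_hom_mult dd_perm_add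
      by (rule const_coeff_simps)
    obtain P where P: "finite P" "P \<subseteq> finitary_perms" "\<And>u. u \<in> P \<Longrightarrow> state_step (adj i ` I) m u v'"
      "\<And>f. const_coeff (dd_perm v' (complete_hom (adj i ` I) m * f)) = (\<Sum>u\<in>P. const_coeff (dd_perm u f))"
      using less.hyps[OF len pos_state_keep[OF less.prems desc i1, folded v'_def], of m] by blast
    define K where "K = (\<lambda>u. u \<circ> adj i) ` {u \<in> P. u i < u (Suc i)}"
    have K: "finite K" "K \<subseteq> finitary_perms" "\<And>u. u \<in> K \<Longrightarrow> state_step I m u v"
      using P i1 state_step_keep[OF less.prems desc i1] finitary_perms_adj
      unfolding K_def v'_def by auto
    have Kdesc: "u (Suc i) < u i" if "u \<in> K" for u
      using that by (auto simp: K_def)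
    have Ksum: "const_coeff (dd_perm v' (complete_hom (adj i ` I) m * dd i f)) = (\<Sum>u\<in>K. const_coeff (dd_perm u f))" for f
      unfolding P(4) K_def by (rule sum_dd_perm_dd[OF P(1,2) i1])
    show ?thesis
    proof (cases "Suc i \<notin> I \<and> m \<noteq> 0")
      case True
      then obtain n where m: "m = Suc n" by (cases m) auto
      have SI: "Suc i \<notin> I" using True by simp
      obtain Q where Q: "finite Q" "Q \<subseteq> finitary_perms" "\<And>u. u \<in> Q \<Longrightarrow> state_step (insert (Suc i) I) n u v'"
        "\<And>f. const_coeff (dd_perm v' (complete_hom (insert (Suc i) I) n * f)) = (\<Sum>u\<in>Q. const_coeff (dd_perm u f))"
        using less.hyps[OF len pos_state_delete[OF less.prems desc i1, folded v'_def], of n] by blast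
      have Qs: "state_step I m u v" "u i < u (Suc i)" if "u \<in> Q" for u
        using state_step_delete[OF less.prems desc i1 SI, of u n] Q(2,3) that unfolding m v'_def by auto
      have disj: "K \<inter> Q = {}"
      proof (rule equals0I)
        fix u assume "u \<in> K \<inter> Q"
        then show False using Kdesc[of u] Qs(2)[of u] by simp
      qed
      have "const_coeff (dd_perm v (complete_hom I m * f)) = (\<Sum>u\<in>K \<union> Q. const_coeff (dd_perm u f))" for f
        unfolding ddv Ksum sum.union_disjoint[OF K(1) Q(1) disj]
        unfolding m dd_complete_hom[OF pos_stateD(2)[OF less.prems] iI SI] Q(4) by (rule add.commute)
      then show ?thesis
        using K Q(1,2) Qs(1) by (intro exI[of _ "K \<union> Q"]) auto
    next
      \<comment> \<open>For m = 0, or when i + 1 lies in I along with i, the complete homogeneous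
        factor is invariant under the swap and only the kept branch survives.\<close>
      case False
      have dd0: "dd i (complete_hom I m) = 0"
      proof (cases "m = 0")
        case True
        then show ?thesis by simp
      next
        case F: False
        then show ?thesis using False iI by (intro dd_complete_hom_eq_0) auto
      qed
      have "const_coeff (dd_perm v (complete_hom I m * f)) = (\<Sum>u\<in>K. const_coeff (dd_perm u f))" for f
        unfolding ddv Ksum dd0 by simp
      then show ?thesis using K by (intro exI[of _ K]) auto
    qed
  qed
qed

text \<open>The clause on positions beyond k is vacuous for Grassmannian v and survives the
  reduction to that case. It later forces the moved positions beyond N to form an initial
  segment.\<close>

definition pieri_step :: "nat \<Rightarrow> nat \<Rightarrow> (nat \<Rightarrow> nat) \<Rightarrow> (nat \<Rightarrow> nat) \<Rightarrow> bool" where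
  "pieri_step k m u v \<longleftrightarrow> (\<exists>r. block_step {1..k} u v r \<and> noncrossing v r) \<and>
     (\<forall>x y. k < x \<longrightarrow> x < y \<longrightarrow> v y < v x \<longrightarrow> u y < u x) \<and>
     card (moved {1..k} u v) = m"

lemma pieri_step_keep:
  assumes "pieri_step k m u (v \<circ> adj i)" "i \<noteq> k" "1 \<le> i" "u i < u (Suc i)"
  shows "pieri_step k m (u \<circ> adj i) v"
proof -
  have im: "adj i ` {1..k} = {1..k}"
    using assms(2,3) by (intro adj_image_eq) auto
  have vv: "v \<circ> adj i \<circ> adj i = v" by (simp add: comp_assoc)
  obtain r where r: "block_step {1..k} u (v \<circ> adj i) r" "noncrossing (v \<circ> adj i) r"
    and ord: "\<And>x y. k < x \<Longrightarrow> x < y \<Longrightarrow> v (adj i y) < v (adj i x) \<Longrightarrow> u y < u x"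
    and card: "card (moved {1..k} u (v \<circ> adj i)) = m"
    using assms(1) by (auto simp: pieri_step_def)
  have "block_step {1..k} (u \<circ> adj i) v (adj i \<circ> r \<circ> adj i)"
    "noncrossing v (adj i \<circ> r \<circ> adj i)"
    using block_step_conj[OF r(1), of i] noncrossing_conj[OF r(2), of i] by (simp_all only: im vv)
  moreover have "(u \<circ> adj i) y < (u \<circ> adj i) x" if "k < x" "x < y" "v y < v x" for x y
  proof (cases "x = i \<and> y = Suc i")
    case True
    then show ?thesis using assms(4) by simp
  next
    case False
    have "k < adj i x" using that(1) assms(2) by (auto simp: transpose_def)
    then show ?thesis using ord[of "adj i x" "adj i y"] adj_less[OF that(2) False] that(3) by simp
  qed
  moreover have "card (moved {1..k} (u \<circ> adj i) v) = m"
    using card_moved_conj[of i "{1..k}" u "v \<circ> adj i"] card by (simp only: im vv)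
  ultimately show ?thesis
    unfolding pieri_step_def by blast
qed

lemma pos_state_grassmannian:
  assumes "v \<in> finitary_perms" "\<And>i. i \<noteq> k \<Longrightarrow> \<not> v (Suc i) < v i"
  shows "pos_state v {1..k}" "\<And>x y. k < x \<Longrightarrow> x < y \<Longrightarrow> v x < v y"
proof -
  have asc: "v i < v (Suc i)" if "i \<noteq> k" for i
    using assms(2)[OF that] finitary_perms_inj[OF assms(1), of i "Suc i"] by linarith
  show inc: "v x < v y" if "k < x" "x < y" for x y
  proof (rule increasing_from[where v = v and a = "Suc k" and b = y])
    show "v j < v (Suc j)" if "Suc k \<le> j" for j using asc[of j] that by simp
  qed (use that in auto)
  have low: "v x < v y" if "x < y" "y \<le> k" for x y
  proof (rule increasing_from[where v = v and a = 0 and b = k])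
    show "v j < v (Suc j)" if "j < k" for j using asc[of j] that by simp
  qed (use that in auto)
  have "v 0 < v y" if "0 < y" for y
    using that finitary_perms_zero[OF assms(1)] finitary_perms_inj[OF assms(1), of 0 y] by auto
  then have "v x < v y" if "x \<notin> {1..k}" "x < y" for x y
    using that inc[of x y] by (cases "x = 0") auto
  then show "pos_state v {1..k}"
    unfolding pos_state_def using assms(1) low by auto
qed

text \<open>A position whose value is not maximal in its block lies beyond k, hence never left of a
  label in {1..k}; so the weakened crossing condition excludes all crossings. Position 0 is fixed
  and forms its own block.\<close>

lemma pieri_step_if_state_step:
  assumes "state_step {1..k} m u v" "u \<in> finitary_perms" "v \<in> finitary_perms"
    "\<And>x y. k < x \<Longrightarrow> x < y \<Longrightarrow> v x < v y"
  shows "pieri_step k m u v"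
proof -
  have surj: "surj u" using finitary_perms_bij[OF assms(2)] by (rule bij_is_surj)
  obtain r where bs: "block_step {1..k} u v r"
    and nc: "\<And>c d c' d'. r c = r c' \<Longrightarrow> r d = r d' \<Longrightarrow> v c < v d \<Longrightarrow> v d < v c' \<Longrightarrow>
      v c' < v d' \<Longrightarrow> r c \<noteq> r d \<Longrightarrow> c < r d"
    and card: "card (moved {1..k} u v) = m"
    using assms(1) unfolding state_step_def by blast
  have r0: "r 0 = 0"
    using block_step_fix[OF bs, of 0] finitary_perms_zero[OF assms(2)] finitary_perms_zero[OF assms(3)]
    by simp
  have "noncrossing v r"
    unfolding noncrossing_def
  proof (intro allI impI)
    fix c d c' d'
    assume h: "r c = r c'" "r d = r d'" "v c < v d" "v d < v c'" "v c' < v d'"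
    show "r c = r d"
    proof (rule ccontr)
      assume "r c \<noteq> r d"
      then have "c < r d" using nc[OF h] by simp
      moreover have "c \<notin> {1..k}" "r c \<in> {1..k}"
        using block_step_nonmax[OF bs surj h(1)] h by auto
      moreover have "r d \<in> {1..k}"
        using block_step_nonmax(2)[OF bs surj h(2)] h by auto
      ultimately have "c = 0" by auto
      then show False using r0 \<open>r c \<in> {1..k}\<close> by simp
    qed
  qed
  moreover have "\<not> v y < v x" if "k < x" "x < y" for x y
    using assms(4)[OF that] by simp
  ultimately show ?thesis
    unfolding pieri_step_def using bs card by blast
qed

text \<open>
  Pieri's rule in dual form.  Divided differences at \<open>i \<noteq> k\<close> commute with multiplication by a
  polynomial that is symmetric in \<open>x_1, \<dots>, x_k\<close>, which reduces it to Grassmannian \<open>v\<close>.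
\<close>

theorem pieri:
  assumes "v \<in> finitary_perms"
  shows "\<exists>P. finite P \<and> P \<subseteq> finitary_perms \<and> (\<forall>u\<in>P. pieri_step k m u v) \<and>
    (\<forall>f. const_coeff (dd_perm v (complete_hom {1..k} m * f)) = (\<Sum>u\<in>P. const_coeff (dd_perm u f)))"
  using assms
proof (induction "perm_length v" arbitrary: v rule: less_induct)
  case less
  show ?case
  proof (cases "\<exists>i. i \<noteq> k \<and> v (Suc i) < v i")
    case True
    then obtain i where ik: "i \<noteq> k" and d: "v (Suc i) < v i" by blast
    have i1: "1 \<le> i" by (rule descent_pos[OF less.prems d])
    define v' where "v' = v \<circ> adj i"
    have len: "perm_length v' < perm_length v"
      using perm_length_adj[OF less.prems d] by (simp add: v'_def)
    have iff: "i \<in> {1..k} \<longleftrightarrow> Suc i \<in> {1..k}" using ik i1 by auto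
    obtain P where P: "finite P" "P \<subseteq> finitary_perms" "\<And>u. u \<in> P \<Longrightarrow> pieri_step k m u v'"
      "\<And>f. const_coeff (dd_perm v' (complete_hom {1..k} m * f)) = (\<Sum>u\<in>P. const_coeff (dd_perm u f))"
      using less.hyps[OF len] finitary_perms_adj[OF less.prems i1] unfolding v'_def by blast
    define K where "K = (\<lambda>u. u \<circ> adj i) ` {u \<in> P. u i < u (Suc i)}"
    have K: "finite K" "K \<subseteq> finitary_perms" "\<forall>u\<in>K. pieri_step k m u v"
      using P i1 ik pieri_step_keep finitary_perms_adj unfolding K_def v'_def by auto
    have "const_coeff (dd_perm v (complete_hom {1..k} m * f)) = (\<Sum>u\<in>K. const_coeff (dd_perm u f))" for f
      unfolding dd_perm_descent[OF less.prems d] v'_def[symmetric] dd_complete_hom_mult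
        dd_complete_hom_eq_0[OF iff] adj_image_eq[OF iff] mult_zero_left add_0_left P(4) K_def
      by (rule sum_dd_perm_dd[OF P(1,2) i1])
    with K show ?thesis by blast
  next
    case False
    then have nd: "\<not> v (Suc i) < v i" if "i \<noteq> k" for i using that by blast
    have gr: "pos_state v {1..k}"
      by (rule pos_state_grassmannian(1)[OF less.prems]) (rule nd)
    have inc: "v x < v y" if "k < x" "x < y" for x y
      by (rule pos_state_grassmannian(2)[OF less.prems _ that]) (rule nd)
    obtain P where P: "finite P" "P \<subseteq> finitary_perms" "\<forall>u\<in>P. state_step {1..k} m u v"
      "\<forall>f. const_coeff (dd_perm v (complete_hom {1..k} m * f)) = (\<Sum>u\<in>P. const_coeff (dd_perm u f))"
      using pieri_state[OF gr, of m] by blast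
    have "\<forall>u\<in>P. pieri_step k m u v"
    proof
      fix u assume u: "u \<in> P"
      show "pieri_step k m u v"
      proof (rule pieri_step_if_state_step[OF _ _ less.prems])
        show "state_step {1..k} m u v" "u \<in> finitary_perms" using P(2,3) u by blast+
        show "v x < v y" if "k < x" "x < y" for x y
          by (rule inc[OF that])
      qed
    qed
    with P show ?thesis by blast
  qed
qed

section \<open>Counting the intermediate permutations\<close>

lemma initial_segment_eq:
  assumes "finite T" "\<And>x. x \<in> T \<Longrightarrow> N < x" "\<And>x. Suc x \<in> T \<Longrightarrow> N < x \<Longrightarrow> x \<in> T"
  shows "T = {N<..N + card T}"
proof (cases "T = {}")
  case False
  define M where "M = Max T"
  have M: "M \<in> T" "\<And>x. x \<in> T \<Longrightarrow> x \<le> M" using assms(1) False by (auto simp: M_def)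
  have "M - j \<in> T" if "N + j < M" for j
    using that
  proof (induction j)
    case (Suc j)
    then show ?case using assms(3)[of "M - Suc j"] by (simp add: Suc_diff_Suc)
  qed (use M in simp)
  then have "x \<in> T" if "N < x" "x \<le> M" for x
    using that by (metis add_less_cancel_right diff_diff_cancel le_add_diff_inverse)
  then have "T = {N<..M}" using M assms(2) by auto
  moreover from this have "card T = M - N" by simp
  moreover have "N < M" using assms(2) M by blast
  ultimately show ?thesis by simp
qed simp

text \<open>Beyond N the permutation w is the identity. If x + 1 moved and x did not, u would have
  an inversion (x, x + 1) that w lacks. So the moved positions beyond N are consecutive from N + 1,
  and m fixes their number.\<close>

lemma moved_determined:
  assumes w: "w permutes {1..N}" and k: "k \<le> N" and u: "u \<in> finitary_perms"
    and step: "pieri_step k m w u"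
  shows "moved {1..k} w u = (moved {1..k} w u \<inter> {k<..N}) \<union>
    {N<..N + (m - card (moved {1..k} w u \<inter> {k<..N}))}"
proof -
  let ?B = "moved {1..k} w u"
  have wf: "w \<in> finitary_perms" using w by (auto simp: finitary_perms_def)
  have fin: "finite ?B" by (rule finite_moved[OF wf u])
  have wo: "w x = x" if "N < x" for x using w that by (simp add: permutes_def)
  obtain r where bs: "block_step {1..k} w u r"
    and ord: "\<And>x y. k < x \<Longrightarrow> x < y \<Longrightarrow> u y < u x \<Longrightarrow> w y < w x"
    and card: "card ?B = m"
    using step by (auto simp: pieri_step_def)
  define T where "T = ?B \<inter> {N<..}"
  have "k < b" if "b \<in> ?B" for b
    using that finitary_perms_zero[OF wf] finitary_perms_zero[OF u] by (cases "b = 0") (auto simp: moved_def)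
  then have split: "?B = (?B \<inter> {k<..N}) \<union> T" by (auto simp: T_def)
  have disj: "(?B \<inter> {k<..N}) \<inter> T = {}" by (auto simp: T_def)
  have "T = {N<..N + card T}"
  proof (rule initial_segment_eq)
    show "finite T" using fin by (simp add: T_def)
    show "N < x" if "x \<in> T" for x using that by (simp add: T_def)
    show "x \<in> T" if x: "Suc x \<in> T" "N < x" for x
    proof (rule ccontr)
      assume "x \<notin> T"
      then have "u x = w x" using x k by (auto simp: T_def moved_def)
      then have ux: "u x = x" using wo[OF x(2)] by simp
      have SB: "Suc x \<notin> {1..k}" "u (Suc x) \<noteq> w (Suc x)" using x by (auto simp: T_def moved_def)
      then have "u (Suc x) < Suc x" using block_step_drop[OF bs SB(1)] wo[of "Suc x"] x by simp
      moreover have "u (Suc x) \<noteq> u x" using finitary_perms_inj[OF u] by simp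
      ultimately have "w (Suc x) < w x" using ord[of x "Suc x"] ux x k by simp
      then show False using wo[of x] wo[of "Suc x"] x by simp
    qed
  qed
  moreover have "card T = m - card (?B \<inter> {k<..N})"
  proof -
    have "card ?B = card (?B \<inter> {k<..N}) + card T"
      using split disj fin by (metis card_Un_disjoint finite_Un)
    then show ?thesis using card by simp
  qed
  ultimately show ?thesis using split by simp
qed

lemma card_intermediate_le:
  assumes w: "w permutes {1..N}" and k: "k \<le> N" and v: "v \<in> finitary_perms"
    and U: "\<And>u. u \<in> U \<Longrightarrow> u \<in> finitary_perms \<and> pieri_step k a w u \<and> pieri_step k b u v"
  shows "card U \<le> 2 ^ (N - k)"
proof -
  have wf: "w \<in> finitary_perms" using w by (auto simp: finitary_perms_def)
  define S where "S u = moved {1..k} w u \<inter> {k<..N}" for u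
  have "inj_on S U"
  proof (rule inj_onI)
    fix u u' assume uu: "u \<in> U" "u' \<in> U" "S u = S u'"
    have fin: "u \<in> finitary_perms" "u' \<in> finitary_perms" using U uu by blast+
    have steps: "pieri_step k a w u" "pieri_step k a w u'" "pieri_step k b u v" "pieri_step k b u' v"
      using U uu by blast+
    have "moved {1..k} w u = moved {1..k} w u'"
      using moved_determined[OF w k fin(1) steps(1)] moved_determined[OF w k fin(2) steps(2)] uu(3)
      unfolding S_def by simp
    then have same: "u x = w x \<longleftrightarrow> u' x = w x" if "x \<notin> {1..k}" for x
      using that by (auto simp: moved_def)
    have lower: "\<exists>r. block_step {1..k} w z r \<and> noncrossing w r"
      if z: "z \<in> finitary_perms" "pieri_step k a w z" for z
    proof -
      obtain r where r: "block_step {1..k} w z r" "noncrossing z r"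
        using z(2) unfolding pieri_step_def by blast
      then show ?thesis
        using noncrossing_lower[OF r(1) bij_is_surj[OF finitary_perms_bij[OF z(1)]] r(2)] by blast
    qed
    obtain r r' where r: "block_step {1..k} w u r" "noncrossing w r"
      "block_step {1..k} w u' r'" "noncrossing w r'"
      using lower[OF fin(1) steps(1)] lower[OF fin(2) steps(2)] by blast
    obtain s s' where s: "block_step {1..k} u v s" "block_step {1..k} u' v s'"
      using steps(3,4) unfolding pieri_step_def by blast
    show "u = u'"
      by (rule intermediate_perm_unique[OF wf fin v r s]) (rule same)
  qed
  moreover have "S ` U \<subseteq> Pow {k<..N}" by (auto simp: S_def)
  ultimately have "card U \<le> card (Pow {k<..N})"
    by (intro card_inj_on_le) auto
  then show ?thesis by (simp add: card_Pow)
qed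

text \<open>Expanding the outer factor at v yields the middle permutations u, and expanding the
  inner factor at u leads to w; by duality the coefficient counts those u whose expansion contains
  w. The lower bound serves the subtracted Jacobi--Trudi product.\<close>

lemma double_pieri_bounds:
  fixes a b :: nat
  assumes w: "w permutes {1..N}" and k: "k \<le> N" and v: "v \<in> finitary_perms"
  defines "C \<equiv> const_coeff (dd_perm v (complete_hom {1..k} b * (complete_hom {1..k} a * schubert w)))"
  shows "0 \<le> C" "C \<le> 2 ^ (N - k)"
proof -
  have wf: "w \<in> finitary_perms" using w by (auto simp: finitary_perms_def)
  define expands where "expands m v P \<longleftrightarrow> finite P \<and> P \<subseteq> finitary_perms \<and> (\<forall>u\<in>P. pieri_step k m u v) \<and>
    (\<forall>f. const_coeff (dd_perm v (complete_hom {1..k} m * f)) = (\<Sum>u\<in>P. const_coeff (dd_perm u f)))" for m v P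
  have ex: "\<exists>P. expands m x P" if "x \<in> finitary_perms" for m x
    unfolding expands_def by (rule pieri[OF that])
  have expandsD: "finite P" "P \<subseteq> finitary_perms" "\<And>u. u \<in> P \<Longrightarrow> pieri_step k m u x"
    "\<And>f. const_coeff (dd_perm x (complete_hom {1..k} m * f)) = (\<Sum>u\<in>P. const_coeff (dd_perm u f))"
    if "expands m x P" for m x P
    using that unfolding expands_def by blast+
  obtain P where "expands b v P" using ex[OF v] by blast
  note P = expandsD[OF this]
  define Q where "Q u = (SOME R. expands a u R)" for u
  have Q': "expands a u (Q u)" if "u \<in> P" for u
    unfolding Q_def by (rule someI_ex, rule ex, rule subsetD[OF P(2) that])
  note Q = expandsD[OF Q']
  define U where "U = {u \<in> P. w \<in> Q u}"
  have "const_coeff (dd_perm u (complete_hom {1..k} a * schubert w)) = (if w \<in> Q u then 1 else 0)"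
    if u: "u \<in> P" for u
  proof -
    have "(\<Sum>x\<in>Q u. const_coeff (dd_perm x (schubert w))) = (\<Sum>x\<in>Q u. if x = w then 1 else 0)"
      using Q(2)[OF u] by (intro sum.cong schubert_dual wf) auto
    then show ?thesis
      unfolding Q(4)[OF u] using Q(1)[OF u] by simp
  qed
  then have "C = (\<Sum>u\<in>P. if w \<in> Q u then 1 else 0)"
    unfolding C_def P(4) by (intro sum.cong) auto
  then have C: "C = int (card U)"
    using P(1) by (simp add: U_def flip: sum.inter_filter)
  then show "0 \<le> C" by simp
  have "card U \<le> 2 ^ (N - k)"
    using P(2,3) Q(3) by (intro card_intermediate_le[OF w k v]) (auto simp: U_def)
  then have "int (card U) \<le> int (2 ^ (N - k))" by (rule of_nat_mono)
  then show "C \<le> 2 ^ (N - k)" by (simp add: C)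
qed

text \<open>By Jacobi--Trudi the coefficient is that of h_m1 h_m2 minus that of h_(m1+1) h_(m2-1),
  and the latter is nonnegative.\<close>

lemma schubert_schur_coeff_le:
  assumes w: "w permutes {1..N}" and k: "k \<le> N" and v: "v \<in> finitary_perms"
    and m: "m2 \<le> m1" "0 < m2"
  shows "const_coeff (dd_perm v (schubert w * schur k [m1, m2])) \<le> 2 ^ (N - k)"
proof -
  obtain b where b: "m2 = Suc b" using m(2) by (cases m2) auto
  let ?h = "complete_hom {1..k}"
  have "schubert w * schur k [m1, m2] + ?h b * (?h (Suc m1) * schubert w) =
      (schur k [m1, m2] + ?h (Suc m1) * ?h b) * schubert w"
    by (simp add: algebra_simps)
  also have "\<dots> = ?h m2 * (?h m1 * schubert w)"
    using schur_two_rows_plus[of b m1 k] m(1) unfolding b by (simp only: mult_ac)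
  finally have "const_coeff (dd_perm v (schubert w * schur k [m1, m2])) +
      const_coeff (dd_perm v (?h b * (?h (Suc m1) * schubert w))) =
      const_coeff (dd_perm v (?h m2 * (?h m1 * schubert w)))"
    by (metis const_coeff_simps(3) dd_perm_add)
  then show ?thesis
    using double_pieri_bounds(1)[OF w k v, of b "Suc m1"] double_pieri_bounds(2)[OF w k v, of m2 m1]
    by linarith
qed

lemma schubert_coeff:
  assumes "finite {v. c v \<noteq> 0}" "{v. c v \<noteq> 0} \<subseteq> finitary_perms" "v \<in> finitary_perms"
  shows "const_coeff (dd_perm v (\<Sum>x | c x \<noteq> 0. of_int (c x) * schubert x)) = c v"
proof -
  have "const_coeff (dd_perm v (\<Sum>x | c x \<noteq> 0. of_int (c x) * schubert x)) =
      (\<Sum>x | c x \<noteq> 0. c x * const_coeff (dd_perm v (schubert x)))"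
    by (simp add: dd_perm_sum const_coeff_sum dd_perm_of_int_mult)
  also have "\<dots> = (\<Sum>x | c x \<noteq> 0. if v = x then c x else 0)"
    using assms by (intro sum.cong) (auto simp: schubert_dual)
  also have "\<dots> = c v"
    using assms(1) by (simp add: sum.delta')
  finally show ?thesis .
qed

theorem theorem1p2:
  fixes n1 n2 n k m1 m2 :: nat
    and \<tau> w :: "nat \<Rightarrow> nat"
    and c :: "(nat \<Rightarrow> nat) \<Rightarrow> int"
  assumes "n1 > 0" and "n2 > 0" and "n = max n1 n2"
    and "grassmannian n1 k \<tau>"
    and "grassmannian_shape k \<tau> = [m1, m2]"
    and "m1 \<ge> m2" and "m2 > 0"
    and "w permutes {1..n2}"
    and "finite {v. c v \<noteq> 0}" and "{v. c v \<noteq> 0} \<subseteq> finitary_perms"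
    and "schubert w * schur k [m1, m2] = (\<Sum>v | c v \<noteq> 0. of_int (c v) * schubert v)"
    and "n2 - k < m2"
  shows "(\<forall>v. c v \<le> 2 ^ (n2 - k) * fact (n2 - k)) \<and>
    (strict_antimono_on {k+1..n2} w \<longrightarrow> (\<forall>v. c v \<le> 2 ^ (n2 - k)))"
proof -
  \<comment> \<open>k may exceed n2, whereas the counting lemmas assume k \<le> N. Taking N = max n2
    k leaves the exponent unchanged, since natural subtraction truncates.\<close>
  have w: "w permutes {1..max n2 k}"
    by (rule permutes_mono_atLeastAtMost[OF assms(8)]) simp
  have le: "c v \<le> 2 ^ (n2 - k)" for v
  proof (cases "c v = 0")
    case False
    then have v: "v \<in> finitary_perms" using assms(10) by blast
    have "c v = const_coeff (dd_perm v (schubert w * schur k [m1, m2]))"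
      unfolding assms(11) by (rule schubert_coeff[OF assms(9,10) v, symmetric])
    also have "\<dots> \<le> 2 ^ (max n2 k - k)"
      by (rule schubert_schur_coeff_le[OF w _ v assms(6,7)]) simp
    also have "max n2 k - k = n2 - k" by simp
    finally show ?thesis .
  qed simp
  moreover have "c v \<le> 2 ^ (n2 - k) * fact (n2 - k)" for v
  proof -
    have "(2 ^ (n2 - k) :: int) * 1 \<le> 2 ^ (n2 - k) * fact (n2 - k)"
      by (intro mult_left_mono fact_ge_1) simp
    with le[of v] show ?thesis by linarith
  qed
  ultimately show ?thesis by blast
qed

end
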